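(* For every $n\geq 4$, the Vietoris–Rips complex $\mathcal{VR}(\mathcal{F}_1^n\cup\mathcal{F}_2^n\cup\mathcal{F}_3^n;3)$ is homotopy equivalent to a wedge sum of $\binom{n}{4}$ copies of $S^6$.
   Context: $\mathcal{F}_k^n$ denotes the collection of all $k$-element subsets of $[n]=\{1,\dots,n\}$; subsets are equipped with the metric $d(A,B)=|A\Delta B|$. For a metric space $X$ and $r\ge0$, $\mathcal{VR}(X;r)$ is the simplicial complex on $X$ whose simplices are the nonempty finite subsets of diameter $\le r$. *)

theory Defs
  imports "HOL-Analysis.Analysis"
begin

definition layer :: "nat \<Rightarrow> nat \<Rightarrow> nat set set" where
  "layer n k = {A. A \<subseteq> {1..n} \<and> card A = k}"

definition symdiff_dist :: "'a set \<Rightarrow> 'a set \<Rightarrow> real" where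
  "symdiff_dist A B = real (card (sym_diff A B))"

lemma Metric_space_symdiff_dist: "Metric_space {A. finite A} symdiff_dist"
proof
  fix A B C :: "'a set"
  show "0 \<le> symdiff_dist A B"
    by (simp add: symdiff_dist_def)
  show "symdiff_dist A B = symdiff_dist B A"
    by (simp add: symdiff_dist_def Un_commute)
  assume A: "A \<in> {A. finite A}" and B: "B \<in> {A. finite A}"
  then show "symdiff_dist A B = 0 \<longleftrightarrow> A = B"
    by (auto simp: symdiff_dist_def)
  assume C: "C \<in> {A. finite A}"
  have "card (sym_diff A C) \<le> card (sym_diff A B \<union> sym_diff B C)"
    using A B C by (intro card_mono) auto
  also have "\<dots> \<le> card (sym_diff A B) + card (sym_diff B C)"
    by (rule card_Un_le)
  finally show "symdiff_dist A C \<le> symdiff_dist A B + symdiff_dist B C"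
    by (simp add: symdiff_dist_def)
qed

text \<open>The library's \<open>diameter\<close> is tied to the type class of metric spaces; this is the same formula
  for an explicitly given distance function. It is only applied to finite nonempty sets.\<close>

definition diam :: "('a \<Rightarrow> 'a \<Rightarrow> real) \<Rightarrow> 'a set \<Rightarrow> real" where
  "diam d S = (SUP (x, y) \<in> S \<times> S. d x y)"

definition Vietoris_Rips :: "'a set \<Rightarrow> ('a \<Rightarrow> 'a \<Rightarrow> real) \<Rightarrow> real \<Rightarrow> 'a set set" where
  "Vietoris_Rips M d r = {\<sigma>. \<sigma> \<subseteq> M \<and> finite \<sigma> \<and> \<sigma> \<noteq> {} \<and> diam d \<sigma> \<le> r}"

lemma diam_le_iff:
  assumes "finite S" "S \<noteq> {}"
  shows "diam d S \<le> r \<longleftrightarrow> (\<forall>x\<in>S. \<forall>y\<in>S. d x y \<le> r)"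
  unfolding diam_def
  by (subst cSUP_le_iff) (use assms in auto)

text \<open>Points of the geometric realization are given by their barycentric coordinates. A simplex is
  topologized as a subspace of \<open>powertop_real UNIV\<close>, which on functions supported in a
  fixed finite set is the Euclidean topology; the realization of a complex carries the weak
  (coherent) topology with respect to its closed simplices.\<close>

definition geom_simplex :: "'v set \<Rightarrow> ('v \<Rightarrow> real) set" where
  "geom_simplex \<sigma> = {x. (\<forall>v. 0 \<le> x v) \<and> (\<forall>v. v \<notin> \<sigma> \<longrightarrow> x v = 0) \<and> (\<Sum>v\<in>\<sigma>. x v) = 1}"

definition geom_realization :: "'v set set \<Rightarrow> ('v \<Rightarrow> real) topology" where
  "geom_realization K = topology (\<lambda>U. U \<subseteq> (\<Union>\<sigma>\<in>K. geom_simplex \<sigma>) \<and>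
     (\<forall>\<sigma>\<in>K. openin (subtopology (powertop_real UNIV) (geom_simplex \<sigma>)) (U \<inter> geom_simplex \<sigma>)))"

lemma openin_geom_realization:
  "openin (geom_realization K) U \<longleftrightarrow> U \<subseteq> (\<Union>\<sigma>\<in>K. geom_simplex \<sigma>) \<and>
     (\<forall>\<sigma>\<in>K. openin (subtopology (powertop_real UNIV) (geom_simplex \<sigma>)) (U \<inter> geom_simplex \<sigma>))"
proof -
  have 1: "S \<inter> T \<inter> G = (S \<inter> G) \<inter> (T \<inter> G)" for S T G :: "('v \<Rightarrow> real) set"
    by auto
  have 2: "\<Union>\<K> \<inter> G = (\<Union>S\<in>\<K>. S \<inter> G)" for \<K> and G :: "('v \<Rightarrow> real) set"
    by auto
  have "istopology (\<lambda>U. U \<subseteq> (\<Union>\<sigma>\<in>K. geom_simplex \<sigma>) \<and>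
     (\<forall>\<sigma>\<in>K. openin (subtopology (powertop_real UNIV) (geom_simplex \<sigma>)) (U \<inter> geom_simplex \<sigma>)))"
    unfolding istopology_def
  proof (intro conjI allI impI ballI; (elim conjE)?)
    fix \<sigma> S T
    assume "\<sigma> \<in> K"
      and "\<forall>\<sigma>\<in>K. openin (subtopology (powertop_real UNIV) (geom_simplex \<sigma>)) (S \<inter> geom_simplex \<sigma>)"
      and "\<forall>\<sigma>\<in>K. openin (subtopology (powertop_real UNIV) (geom_simplex \<sigma>)) (T \<inter> geom_simplex \<sigma>)"
    then show "openin (subtopology (powertop_real UNIV) (geom_simplex \<sigma>)) (S \<inter> T \<inter> geom_simplex \<sigma>)"
      by (subst 1) (rule openin_Int; blast)
  next
    fix \<sigma> \<K>
    assume "\<sigma> \<in> K"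
      and "\<forall>U\<in>\<K>. U \<subseteq> (\<Union>\<sigma>\<in>K. geom_simplex \<sigma>) \<and>
        (\<forall>\<sigma>\<in>K. openin (subtopology (powertop_real UNIV) (geom_simplex \<sigma>)) (U \<inter> geom_simplex \<sigma>))"
    then show "openin (subtopology (powertop_real UNIV) (geom_simplex \<sigma>)) (\<Union>\<K> \<inter> geom_simplex \<sigma>)"
      unfolding 2 by (intro openin_Union) auto
  qed (simp_all add: Sup_le_iff le_infI1)
  then show ?thesis
    by (simp add: geom_realization_def)
qed

lemma topspace_geom_realization: "topspace (geom_realization K) = (\<Union>\<sigma>\<in>K. geom_simplex \<sigma>)"
proof (rule antisym)
  show "topspace (geom_realization K) \<subseteq> (\<Union>\<sigma>\<in>K. geom_simplex \<sigma>)"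
    by (metis openin_geom_realization openin_topspace)
  have "(\<Union>\<tau>\<in>K. geom_simplex \<tau>) \<inter> geom_simplex \<sigma> = geom_simplex \<sigma>" if "\<sigma> \<in> K" for \<sigma>
    using that by blast
  then have "openin (geom_realization K) (\<Union>\<sigma>\<in>K. geom_simplex \<sigma>)"
    by (simp add: openin_geom_realization openin_subtopology_refl)
  then show "(\<Union>\<sigma>\<in>K. geom_simplex \<sigma>) \<subseteq> topspace (geom_realization K)"
    by (rule openin_subset)
qed

definition quotient_topology :: "'a topology \<Rightarrow> ('a \<times> 'a) set \<Rightarrow> 'a set topology" where
  "quotient_topology X r = topology (\<lambda>U. U \<subseteq> topspace X // r \<and>
     openin X {x \<in> topspace X. r `` {x} \<in> U})"

lemma openin_quotient_topology:
  "openin (quotient_topology X r) U \<longleftrightarrow> U \<subseteq> topspace X // r \<and>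
     openin X {x \<in> topspace X. r `` {x} \<in> U}"
proof -
  have 1: "{x \<in> topspace X. r `` {x} \<in> S \<inter> T} =
      {x \<in> topspace X. r `` {x} \<in> S} \<inter> {x \<in> topspace X. r `` {x} \<in> T}" for S T
    by auto
  have 2: "{x \<in> topspace X. r `` {x} \<in> \<Union>\<K>} = (\<Union>S\<in>\<K>. {x \<in> topspace X. r `` {x} \<in> S})" for \<K>
    by auto
  have "istopology (\<lambda>U. U \<subseteq> topspace X // r \<and> openin X {x \<in> topspace X. r `` {x} \<in> U})"
    unfolding istopology_def
  proof (intro conjI allI impI; (elim conjE)?)
    fix S T
    assume "openin X {x \<in> topspace X. r `` {x} \<in> S}" "openin X {x \<in> topspace X. r `` {x} \<in> T}"
    then show "openin X {x \<in> topspace X. r `` {x} \<in> S \<inter> T}"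
      unfolding 1 by (rule openin_Int)
  next
    fix \<K>
    assume "\<forall>U\<in>\<K>. U \<subseteq> topspace X // r \<and> openin X {x \<in> topspace X. r `` {x} \<in> U}"
    then show "openin X {x \<in> topspace X. r `` {x} \<in> \<Union>\<K>}"
      unfolding 2 by (intro openin_Union) auto
  qed (simp_all add: Sup_le_iff le_infI1)
  then show ?thesis
    by (simp add: quotient_topology_def)
qed

lemma topspace_quotient_topology: "topspace (quotient_topology X r) = topspace X // r"
proof (rule antisym)
  show "topspace (quotient_topology X r) \<subseteq> topspace X // r"
    by (metis openin_quotient_topology openin_topspace)
  have "{x \<in> topspace X. r `` {x} \<in> topspace X // r} = topspace X"
    by (auto simp: quotient_def)
  then have "openin (quotient_topology X r) (topspace X // r)"
    by (simp add: openin_quotient_topology)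
  then show "topspace X // r \<subseteq> topspace (quotient_topology X r)"
    by (rule openin_subset)
qed

lemma quotient_map_quotient_topology: "quotient_map X (quotient_topology X r) (\<lambda>x. r `` {x})"
  unfolding quotient_map_def topspace_quotient_topology
  by (auto simp: openin_quotient_topology quotient_def)

text \<open>The wedge sum is the disjoint union with all base points \<open>p i\<close> identified. For an empty index
  set this formula yields the empty space rather than a point.\<close>

definition wedge_rel :: "('i \<Rightarrow> 'a topology) \<Rightarrow> ('i \<Rightarrow> 'a) \<Rightarrow> 'i set \<Rightarrow> (('i \<times> 'a) \<times> ('i \<times> 'a)) set" where
  "wedge_rel X p I = Id_on (topspace (sum_topology X I)) \<union> {((i, p i), (j, p j)) | i j. i \<in> I \<and> j \<in> I}"

definition wedge_sum :: "('i \<Rightarrow> 'a topology) \<Rightarrow> ('i \<Rightarrow> 'a) \<Rightarrow> 'i set \<Rightarrow> ('i \<times> 'a) set topology" where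
  "wedge_sum X p I = quotient_topology (sum_topology X I) (wedge_rel X p I)"

lemma equiv_wedge_rel:
  assumes "\<And>i. i \<in> I \<Longrightarrow> p i \<in> topspace (X i)"
  shows "equiv (topspace (sum_topology X I)) (wedge_rel X p I)"
  using assms by (intro equivI) (auto simp: wedge_rel_def refl_on_def sym_def trans_def)

text \<open>By homogeneity of the sphere, the choice of base point does not affect the wedge sum up to
  homeomorphism.\<close>

definition nsphere_base :: "nat \<Rightarrow> real" where
  "nsphere_base = (\<lambda>i. if i = 0 then 1 else 0)"

lemma nsphere_base_in_nsphere: "nsphere_base \<in> topspace (nsphere m)"
  unfolding nsphere_base_def by (rule in_topspace_nsphere)

definition wedge_of_spheres :: "nat \<Rightarrow> nat \<Rightarrow> (nat \<times> (nat \<Rightarrow> real)) set topology" where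
  "wedge_of_spheres c m = wedge_sum (\<lambda>_. nsphere m) (\<lambda>_. nsphere_base) {..<c}"

end

theory Submission
  imports Defs
begin

text \<open>
  For a 4-subset \<open>S\<close>, the triples and pairs in \<open>S\<close> span, together with the singletons, the boundary of a
  7-dimensional cross-polytope. The simplex \<open>F S\<close> consisting of the four triples of \<open>S\<close> and the three pairs
  avoiding its least element is a facet of the whole complex. Deleting all these 6-dimensional
  facets leaves a contractible complex: the star of a simplex \<open>\<sigma>\<close> can be removed without changing the homotopy
  type whenever all simplices containing \<open>\<sigma>\<close> can be extended by one fixed vertex, and such removals
  first eliminate the simplices containing all four triples of some \<open>S\<close>. The triples in any remaining simplex have
  a common element \<open>v\<close>, and \<open>{v}\<close> is adjacent to the whole simplex; so all triples can be removed, and what is left is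
  a cone over any singleton. A complex obtained from a contractible one by attaching the interiors of
  \<open>c\<close> simplices of dimension 6 is a wedge of \<open>c\<close> spheres: the contraction extends to a homotopy of the whole
  space by radial dilation of the attached simplices, so the quotient map collapsing the
  contractible part is a homotopy equivalence.
\<close>

section \<open>Finite complexes and collapses\<close>

text \<open>Complementary pairs of S are antipodal, so the six pairs form an octahedral 2-sphere. A
  vertex adjacent to all of \<open>triples S\<close> is itself a triple or a pair of S, hence the
  simplices containing \<open>triples S\<close> fill the join of a 3-simplex with this octahedron: a
  6-ball, which is where one 6-sphere per S comes from. \<open>F S\<close> fixes one facet of the
  octahedron. Once this facet is missing, the octahedron is a disc, and the proper faces of the
  facet are deleted by falling dimension: an edge, a vertex, and the empty face, which is
  \<open>triples S\<close> itself. Contractibility is carried backwards along these deletions, from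
  the smaller complex to the larger.

  The obstacle is that all S are treated together and no deletion may destroy the cone point needed
  by another; the open stars of \<open>triples S\<close> and \<open>triples S'\<close> are disjoint
  for distinct S and S', which settles this. Single sets of triples are deleted by decreasing size,
  because only then does a simplex in the star have no triples besides the given ones.\<close>

definition underlying_space :: "'v set set \<Rightarrow> ('v \<Rightarrow> real) set" where
  "underlying_space K = (\<Union>\<sigma>\<in>K. geom_simplex \<sigma>)"

lemma closed_geom_simplex: "closed (geom_simplex \<sigma>)"
proof -
  have "geom_simplex \<sigma> = (\<Inter>v. {x. 0 \<le> x v}) \<inter> (\<Inter>v\<in>-\<sigma>. {x. x v = 0}) \<inter> {x. (\<Sum>v\<in>\<sigma>. x v) = 1}"
    by (auto simp: geom_simplex_def)
  moreover have "closed \<dots>"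
    by (intro closed_Int closed_INT ballI closed_Collect_le closed_Collect_eq continuous_intros
          continuous_on_product_coordinates)
  ultimately show ?thesis by simp
qed

lemma geom_simplex_le_1:
  assumes "x \<in> geom_simplex \<sigma>" "finite \<sigma>"
  shows "x v \<le> 1"
proof (cases "v \<in> \<sigma>")
  case True
  then have "x v \<le> (\<Sum>v\<in>\<sigma>. x v)"
    using assms by (intro member_le_sum) (auto simp: geom_simplex_def)
  then show ?thesis using assms by (simp add: geom_simplex_def)
next
  case False
  then show ?thesis using assms by (simp add: geom_simplex_def)
qed

lemma compact_geom_simplex:
  assumes "finite \<sigma>"
  shows "compact (geom_simplex \<sigma>)"
proof -
  have "compactin (powertop_real UNIV) (PiE UNIV (\<lambda>_. {0..1}))"
    by (simp add: compactin_PiE)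
  then have "compact (PiE UNIV (\<lambda>_. {0..1}) :: ('a \<Rightarrow> real) set)"
    by (simp add: euclidean_product_topology)
  moreover have "geom_simplex \<sigma> = PiE UNIV (\<lambda>_. {0..1}) \<inter> geom_simplex \<sigma>"
    using geom_simplex_le_1[OF _ assms] by (auto simp: geom_simplex_def)
  ultimately show ?thesis
    by (metis closed_geom_simplex compact_Int_closed)
qed

lemma closed_underlying_space: "finite K \<Longrightarrow> closed (underlying_space K)"
  unfolding underlying_space_def by (intro closed_UN ballI closed_geom_simplex)

lemma compact_underlying_space:
  "finite K \<Longrightarrow> (\<And>\<sigma>. \<sigma> \<in> K \<Longrightarrow> finite \<sigma>) \<Longrightarrow> compact (underlying_space K)"
  unfolding underlying_space_def by (intro compact_UN compact_geom_simplex)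

text \<open>A finite union of closed sets is closed, so finitely many closed simplices carry the
  coherent topology as a subspace topology. This turns all later continuity questions into
  \<open>continuous_on\<close> statements.\<close>

lemma geom_realization_eq_underlying_space:
  assumes "finite K"
  shows "geom_realization K = top_of_set (underlying_space K)"
proof (rule topology_eq[THEN iffD2], intro allI iffI)
  fix U :: "('a \<Rightarrow> real) set"
  assume "openin (geom_realization K) U"
  then have sub: "U \<subseteq> underlying_space K"
    and op: "\<And>\<sigma>. \<sigma> \<in> K \<Longrightarrow> openin (top_of_set (geom_simplex \<sigma>)) (U \<inter> geom_simplex \<sigma>)"
    by (auto simp: openin_geom_realization underlying_space_def euclidean_product_topology)
  have "closed (geom_simplex \<sigma> - U)" if "\<sigma> \<in> K" for \<sigma>
  proof -
    have "closedin (top_of_set (geom_simplex \<sigma>)) (geom_simplex \<sigma> - U \<inter> geom_simplex \<sigma>)"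
      using op[OF that] by (simp add: openin_closedin_eq)
    moreover have "geom_simplex \<sigma> - U \<inter> geom_simplex \<sigma> = geom_simplex \<sigma> - U" by blast
    ultimately show ?thesis using closed_geom_simplex closedin_closed_trans by metis
  qed
  then have "closed (\<Union>\<sigma>\<in>K. geom_simplex \<sigma> - U)"
    using assms by (intro closed_UN) auto
  moreover have "U = underlying_space K \<inter> - (\<Union>\<sigma>\<in>K. geom_simplex \<sigma> - U)"
    using sub by (auto simp: underlying_space_def)
  ultimately show "openin (top_of_set (underlying_space K)) U"
    by (metis open_Compl openin_open)
next
  fix U :: "('a \<Rightarrow> real) set"
  assume "openin (top_of_set (underlying_space K)) U"
  then obtain T where T: "open T" "U = underlying_space K \<inter> T" by (auto simp: openin_open)
  have "openin (top_of_set (geom_simplex \<sigma>)) (U \<inter> geom_simplex \<sigma>)" if "\<sigma> \<in> K" for \<sigma>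
  proof -
    have "U \<inter> geom_simplex \<sigma> = geom_simplex \<sigma> \<inter> T" using T that by (auto simp: underlying_space_def)
    then show ?thesis using T by (simp add: openin_open_Int)
  qed
  then show "openin (geom_realization K) U"
    using T by (auto simp: openin_geom_realization underlying_space_def euclidean_product_topology)
qed

lemma continuous_on_Min_image:
  fixes f :: "'v \<Rightarrow> 'a::topological_space \<Rightarrow> real"
  assumes "finite S" "S \<noteq> {}" "\<And>v. v \<in> S \<Longrightarrow> continuous_on U (f v)"
  shows "continuous_on U (\<lambda>x. Min ((\<lambda>v. f v x) ` S))"
  using assms
proof (induction S rule: finite_ne_induct)
  case (insert v S)
  then have "(\<lambda>x. Min ((\<lambda>v. f v x) ` insert v S)) = (\<lambda>x. min (f v x) (Min ((\<lambda>v. f v x) ` S)))"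
    by (auto simp: fun_eq_iff)
  with insert show ?case by (simp add: continuous_on_min)
qed simp

lemma continuous_on_coord:
  fixes f :: "'a::topological_space \<Rightarrow> 'v \<Rightarrow> real"
  assumes "continuous_on S f"
  shows "continuous_on S (\<lambda>x. f x v)"
  using assms by (rule continuous_on_product_then_coordinatewise)

lemma geom_simplex_mono:
  assumes "x \<in> geom_simplex \<sigma>" "\<sigma> \<subseteq> \<tau>" "finite \<tau>"
  shows "x \<in> geom_simplex \<tau>"
proof -
  have "(\<Sum>v\<in>\<tau>. x v) = (\<Sum>v\<in>\<sigma>. x v)"
    using assms by (intro sum.mono_neutral_right) (auto simp: geom_simplex_def)
  then show ?thesis using assms by (auto simp: geom_simplex_def)
qed

lemma geom_simplex_face:
  assumes "x \<in> geom_simplex \<tau>" "finite \<tau>" "\<sigma> \<subseteq> \<tau>" "\<And>v. v \<in> \<tau> - \<sigma> \<Longrightarrow> x v = 0"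
  shows "x \<in> geom_simplex \<sigma>"
proof -
  have "(\<Sum>v\<in>\<tau>. x v) = (\<Sum>v\<in>\<sigma>. x v)"
    using assms by (intro sum.mono_neutral_right) (auto simp: geom_simplex_def)
  then show ?thesis using assms by (auto simp: geom_simplex_def)
qed

lemma geom_simplex_convex_comb:
  assumes "x \<in> geom_simplex \<sigma>" "y \<in> geom_simplex \<sigma>" "0 \<le> t" "t \<le> (1::real)"
  shows "(\<lambda>v. (1 - t) * x v + t * y v) \<in> geom_simplex \<sigma>"
  using assms by (auto simp: geom_simplex_def sum.distrib simp flip: sum_distrib_left)

text \<open>The straight-line homotopy works: the segment from x to \<open>f x\<close> never leaves
  a simplex that holds both ends.\<close>

lemma homotopic_id_if_contiguous:
  assumes f: "continuous_on (underlying_space K) f"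
    and cont: "\<And>x. x \<in> underlying_space K \<Longrightarrow> \<exists>\<rho>\<in>K. x \<in> geom_simplex \<rho> \<and> f x \<in> geom_simplex \<rho>"
  shows "homotopic_with_canon (\<lambda>_. True) (underlying_space K) (underlying_space K) id f"
proof -
  let ?h = "\<lambda>z. \<lambda>v. (1 - fst z) * snd z v + fst z * f (snd z) v"
  have f': "continuous_on ({0..1} \<times> underlying_space K) (\<lambda>z. f (snd z))"
    by (rule continuous_on_compose2[OF f]) (auto intro: continuous_intros)
  have "continuous_on ({0..1} \<times> underlying_space K) ?h"
    by (intro continuous_on_coordinatewise_then_product continuous_on_add continuous_on_mult
        continuous_on_diff continuous_on_const continuous_on_fst continuous_on_id
        continuous_on_coord[OF continuous_on_snd[OF continuous_on_id]] continuous_on_coord[OF f'])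
  moreover have "?h (t, x) \<in> underlying_space K" if tx: "t \<in> {0..1}" "x \<in> underlying_space K" for t x
  proof -
    obtain \<rho> where "\<rho> \<in> K" "x \<in> geom_simplex \<rho>" "f x \<in> geom_simplex \<rho>" using cont[OF tx(2)] by blast
    then show ?thesis using tx geom_simplex_convex_comb[of x \<rho> "f x" t]
      by (auto simp: underlying_space_def)
  qed
  ultimately show ?thesis
    unfolding homotopic_with_def
    by (intro exI[of _ ?h]) auto
qed

text \<open>The constant map to the vertex \<open>w\<close> is contiguous to the identity, since
  every simplex extends by \<open>w\<close>.\<close>

lemma contractible_cone:
  assumes fin: "\<And>\<rho>. \<rho> \<in> K \<Longrightarrow> finite \<rho>" and cone: "\<And>\<rho>. \<rho> \<in> K \<Longrightarrow> insert w \<rho> \<in> K"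
  shows "contractible (underlying_space K)"
proof -
  let ?e = "\<lambda>v. if v = w then 1 else 0 :: real"
  have "homotopic_with_canon (\<lambda>_. True) (underlying_space K) (underlying_space K) id (\<lambda>_. ?e)"
  proof (rule homotopic_id_if_contiguous)
    fix x assume "x \<in> underlying_space K"
    then obtain \<rho> where \<rho>: "\<rho> \<in> K" "x \<in> geom_simplex \<rho>" by (auto simp: underlying_space_def)
    have "?e \<in> geom_simplex (insert w \<rho>)"
      using fin[OF \<rho>(1)] by (auto simp: geom_simplex_def)
    then show "\<exists>\<rho>\<in>K. x \<in> geom_simplex \<rho> \<and> ?e \<in> geom_simplex \<rho>"
      using \<rho> cone fin geom_simplex_mono[OF \<rho>(2), of "insert w \<rho>"] by blast
  qed auto
  then show ?thesis by (auto simp: contractible_def)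
qed

definition deletion :: "'v set set \<Rightarrow> 'v set \<Rightarrow> 'v set set" where
  "deletion K \<sigma> = {\<rho> \<in> K. \<not> \<sigma> \<subseteq> \<rho>}"

text \<open>Pushing mass uniformly from the vertices of \<open>\<sigma>\<close> to the apex \<open>w\<close> of its star
  retracts the star onto the part not containing \<open>\<sigma>\<close>.\<close>

lemma contractible_deletion:
  assumes fin: "\<And>\<rho>. \<rho> \<in> K \<Longrightarrow> finite \<rho>"
    and down: "\<And>\<rho> \<tau>. \<rho> \<in> K \<Longrightarrow> \<tau> \<subseteq> \<rho> \<Longrightarrow> \<tau> \<noteq> {} \<Longrightarrow> \<tau> \<in> K"
    and \<sigma>: "finite \<sigma>" "\<sigma> \<noteq> {}" "w \<notin> \<sigma>"
    and cone: "\<And>\<rho>. \<rho> \<in> K \<Longrightarrow> \<sigma> \<subseteq> \<rho> \<Longrightarrow> insert w \<rho> \<in> K"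
    and con: "contractible (underlying_space (deletion K \<sigma>))"
  shows "contractible (underlying_space K)"
proof -
  \<comment> \<open>For points of the complex, \<open>m x\<close> is the largest mass that can be
    taken from every vertex of \<sigma> at once; it is positive exactly on the open star of
    \<sigma>. The factor \<open>card \<sigma>\<close> in \<open>r\<close> hands all of it to
    \<open>w\<close>, so the total stays 1.\<close>
  define m where "m x = Min ((\<lambda>v. x v) ` \<sigma>)" for x :: "'a \<Rightarrow> real"
  define r where "r x = (\<lambda>v. x v - (if v \<in> \<sigma> then m x else 0) + (if v = w then card \<sigma> * m x else 0))" for x
  have m_cont: "continuous_on U m" for U
    unfolding m_def by (intro continuous_on_Min_image \<sigma> continuous_on_coord[OF continuous_on_id])
  have r_cont: "continuous_on U r" for U
  proof (rule continuous_on_coordinatewise_then_product)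
    show "continuous_on U (\<lambda>x. r x v)" for v
      unfolding r_def
      by (cases "v \<in> \<sigma>"; cases "v = w")
         (auto intro!: continuous_on_add continuous_on_diff continuous_on_mult continuous_on_const
           continuous_on_coord[OF continuous_on_id] m_cont)
  qed
  have m_le: "m x \<le> x v" if "v \<in> \<sigma>" for x v
    using that \<sigma> by (auto simp: m_def)
  have m_att: "\<exists>v\<in>\<sigma>. x v = m x" for x
  proof -
    have "m x \<in> x ` \<sigma>" using \<sigma> unfolding m_def by (intro Min_in) auto
    then show ?thesis by auto
  qed
  have r: "\<exists>\<rho>\<in>K. x \<in> geom_simplex \<rho> \<and> r x \<in> geom_simplex \<rho> \<and> (\<exists>\<tau>\<in>deletion K \<sigma>. r x \<in> geom_simplex \<tau>)"
    if "x \<in> underlying_space K" for x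
  proof -
    obtain \<rho> where \<rho>: "\<rho> \<in> K" "x \<in> geom_simplex \<rho>" using \<open>x \<in> underlying_space K\<close> by (auto simp: underlying_space_def)
    show ?thesis
    proof (cases "\<sigma> \<subseteq> \<rho>")
      case False
      then obtain v where "v \<in> \<sigma>" "x v = 0" using \<rho> by (auto simp: geom_simplex_def)
      moreover have "0 \<le> m x" using m_att[of x] \<rho> by (metis (mono_tags, lifting) geom_simplex_def mem_Collect_eq)
      ultimately have "m x = 0" using m_le[of v x] by simp
      then have "r x = x" by (auto simp: r_def)
      then show ?thesis using \<rho> False by (auto simp: deletion_def)
    next
      case True
      let ?\<rho> = "insert w \<rho>"
      have \<rho>': "?\<rho> \<in> K" "finite ?\<rho>" using cone \<rho> True fin by auto
      have x: "x \<in> geom_simplex ?\<rho>" by (rule geom_simplex_mono[OF \<rho>(2)]) (use \<rho>' in auto)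
      have m0: "0 \<le> m x" using m_att[of x] \<rho> by (metis (mono_tags, lifting) geom_simplex_def mem_Collect_eq)
      have rx: "r x \<in> geom_simplex ?\<rho>"
      proof -
        have "(\<Sum>v\<in>?\<rho>. r x v) = (\<Sum>v\<in>?\<rho>. x v) - (\<Sum>v\<in>?\<rho>. if v \<in> \<sigma> then m x else 0)
            + (\<Sum>v\<in>?\<rho>. if v = w then card \<sigma> * m x else 0)"
          by (simp add: r_def sum.distrib sum_subtractf)
        also have "(\<Sum>v\<in>?\<rho>. if v \<in> \<sigma> then m x else 0) = (\<Sum>v\<in>?\<rho> \<inter> \<sigma>. m x)"
          using \<rho>'(2) by (rule sum.inter_restrict[symmetric])
        also have "?\<rho> \<inter> \<sigma> = \<sigma>" using True by auto
        finally have "(\<Sum>v\<in>?\<rho>. r x v) = 1"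
          using x \<rho>'(2) by (simp add: geom_simplex_def)
        moreover have "0 \<le> r x v" for v
          using x m0 m_le[of v x] by (auto simp: r_def geom_simplex_def)
        moreover have "r x v = 0" if "v \<notin> ?\<rho>" for v
          using that x True by (auto simp: r_def geom_simplex_def)
        ultimately show ?thesis by (auto simp: geom_simplex_def)
      qed
      \<comment> \<open>A vertex of \<sigma> where the minimum is attained loses all its mass, so
        the image lies in a face that omits it and therefore does not contain \<sigma>.\<close>
      obtain v where v: "v \<in> \<sigma>" "x v = m x" using m_att by blast
      have rv: "r x v = 0" using v \<sigma> by (auto simp: r_def)
      have rx': "r x \<in> geom_simplex (?\<rho> - {v})"
      proof (rule geom_simplex_face[OF rx \<rho>'(2)])
        show "r x u = 0" if "u \<in> ?\<rho> - (?\<rho> - {v})" for u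
          using that rv by (metis Diff_Diff_Int Int_iff singletonD)
      qed auto
      have "?\<rho> - {v} \<noteq> {}" using v \<sigma> by auto
      then have "?\<rho> - {v} \<in> deletion K \<sigma>" using v down[OF \<rho>'(1)] by (auto simp: deletion_def)
      then show ?thesis using x rx rx' \<rho>'(1) by blast
    qed
  qed
  have sub: "underlying_space (deletion K \<sigma>) \<subseteq> underlying_space K" by (auto simp: underlying_space_def deletion_def)
  have "homotopic_with_canon (\<lambda>_. True) (underlying_space K) (underlying_space K) id r"
    using r by (intro homotopic_id_if_contiguous r_cont) blast
  moreover have "r \<in> underlying_space K \<rightarrow> underlying_space (deletion K \<sigma>)"
    using r unfolding underlying_space_def[of "deletion K \<sigma>"] by blast
  \<comment> \<open>Having its values in a contractible subspace, \<open>r\<close> is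
    null-homotopic; since it is also homotopic to the identity, the whole space contracts.\<close>
  then obtain a where "homotopic_with_canon (\<lambda>_. True) (underlying_space K) (underlying_space (deletion K \<sigma>)) r (\<lambda>_. a)"
    using nullhomotopic_into_contractible[OF r_cont _ con] by metis
  then have "homotopic_with_canon (\<lambda>_. True) (underlying_space K) (underlying_space K) r (\<lambda>_. a)"
    using sub by (rule homotopic_with_subset_right)
  ultimately show ?thesis
    unfolding contractible_def using homotopic_with_trans by blast
qed

text \<open>The stars are deleted one at a time. The sixth hypothesis is the independence that this
  requires: adding the apex \<open>w i\<close> must not complete another \<sigma> j, for otherwise
  deleting \<sigma> j would remove the cone over a simplex containing \<sigma> i.\<close>

lemma contractible_delete_family:
  assumes "finite I"
    and "\<And>\<rho>. \<rho> \<in> K \<Longrightarrow> finite \<rho>"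
    and "\<And>\<rho> \<tau>. \<rho> \<in> K \<Longrightarrow> \<tau> \<subseteq> \<rho> \<Longrightarrow> \<tau> \<noteq> {} \<Longrightarrow> \<tau> \<in> K"
    and "\<And>i. i \<in> I \<Longrightarrow> finite (\<sigma> i) \<and> \<sigma> i \<noteq> {} \<and> w i \<notin> \<sigma> i"
    and "\<And>i \<rho>. i \<in> I \<Longrightarrow> \<rho> \<in> K \<Longrightarrow> \<sigma> i \<subseteq> \<rho> \<Longrightarrow> insert (w i) \<rho> \<in> K"
    and "\<And>i j \<rho>. i \<in> I \<Longrightarrow> j \<in> I \<Longrightarrow> \<rho> \<in> K \<Longrightarrow> \<sigma> i \<subseteq> \<rho> \<Longrightarrow> i \<noteq> j \<Longrightarrow> \<sigma> j \<subseteq> insert (w i) \<rho>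
      \<Longrightarrow> \<sigma> j \<subseteq> \<rho>"
    and "contractible (underlying_space {\<rho> \<in> K. \<forall>i\<in>I. \<not> \<sigma> i \<subseteq> \<rho>})"
  shows "contractible (underlying_space K)"
  using assms
proof (induction I arbitrary: K rule: finite_induct)
  case empty
  from empty.prems(6) show ?case by simp
next
  case (insert i I)
  note fin = insert.prems(1) and down = insert.prems(2) and \<sigma> = insert.prems(3)
    and cone = insert.prems(4) and indep = insert.prems(5)
  have "contractible (underlying_space (deletion K (\<sigma> i)))"
  proof (rule insert.IH)
    have "{\<rho> \<in> deletion K (\<sigma> i). \<forall>j\<in>I. \<not> \<sigma> j \<subseteq> \<rho>} = {\<rho> \<in> K. \<forall>j\<in>insert i I. \<not> \<sigma> j \<subseteq> \<rho>}"
      by (auto simp: deletion_def)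
    then show "contractible (underlying_space {\<rho> \<in> deletion K (\<sigma> i). \<forall>j\<in>I. \<not> \<sigma> j \<subseteq> \<rho>})"
      using insert.prems(6) by simp
    show "insert (w j) \<rho> \<in> deletion K (\<sigma> i)" if "j \<in> I" "\<rho> \<in> deletion K (\<sigma> i)" "\<sigma> j \<subseteq> \<rho>" for j \<rho>
    proof -
      have \<rho>: "\<rho> \<in> K" "\<not> \<sigma> i \<subseteq> \<rho>" "j \<noteq> i" using that insert.hyps by (auto simp: deletion_def)
      then show ?thesis
        using cone[of j \<rho>] indep[of j i \<rho>] that by (auto simp: deletion_def)
    qed
    show "\<tau> \<in> deletion K (\<sigma> i)" if "\<rho> \<in> deletion K (\<sigma> i)" "\<tau> \<subseteq> \<rho>" "\<tau> \<noteq> {}" for \<rho> \<tau>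
      using that down[of \<rho> \<tau>] by (auto simp: deletion_def)
    show "\<sigma> k \<subseteq> \<rho>" if "j \<in> I" "k \<in> I" "\<rho> \<in> deletion K (\<sigma> i)" "\<sigma> j \<subseteq> \<rho>" "j \<noteq> k" "\<sigma> k \<subseteq> insert (w j) \<rho>" for j k \<rho>
      using that indep[of j k \<rho>] by (auto simp: deletion_def)
    show "finite \<rho>" if "\<rho> \<in> deletion K (\<sigma> i)" for \<rho>
      using that fin[of \<rho>] by (simp add: deletion_def)
    show "finite (\<sigma> j) \<and> \<sigma> j \<noteq> {} \<and> w j \<notin> \<sigma> j" if "j \<in> I" for j
      using that \<sigma>[of j] by simp
  qed
  then show ?case
  proof (rule contractible_deletion[of K "\<sigma> i" "w i", rotated 6])
    show "\<tau> \<in> K" if "\<rho> \<in> K" "\<tau> \<subseteq> \<rho>" "\<tau> \<noteq> {}" for \<rho> \<tau>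
      using that by (rule down)
    show "insert (w i) \<rho> \<in> K" if "\<rho> \<in> K" "\<sigma> i \<subseteq> \<rho>" for \<rho>
      using that by (intro cone) simp_all
  qed (use \<sigma>[of i] fin in simp_all)
qed

section \<open>Wedges of spheres\<close>

text \<open>If a homotopy from the identity respects the fibres of \<open>q\<close> at all times, it
  descends to W; if its end map is constant on fibres, that map factors through W as a homotopy
  inverse \<open>g\<close> of \<open>q\<close>. The homotopy and its descent are the two homotopies
  required.\<close>

lemma homotopy_equivalent_space_quotient:
  assumes X: "compact_space X" and W: "Hausdorff_space W"
    and q: "continuous_map X W q" "q ` topspace X = topspace W"
    and H: "continuous_map (prod_topology (top_of_set {0..1}) X) X H"
    and H0: "\<And>x. x \<in> topspace X \<Longrightarrow> H (0, x) = x"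
    and fibre: "\<And>t x y. \<lbrakk>t \<in> {0..1::real}; x \<in> topspace X; y \<in> topspace X; q x = q y\<rbrakk>
      \<Longrightarrow> q (H (t, x)) = q (H (t, y))"
    and fibre1: "\<And>x y. \<lbrakk>x \<in> topspace X; y \<in> topspace X; q x = q y\<rbrakk> \<Longrightarrow> H (1, x) = H (1, y)"
  shows "X homotopy_equivalent_space W"
proof -
  let ?I = "top_of_set {0..1::real}"
  have quo: "quotient_map X W q"
    by (rule continuous_closed_imp_quotient_map[OF q(1) continuous_imp_closed_map[OF q(1) X W] q(2)])
  have H1: "continuous_map X X (\<lambda>x. H (1, x))"
    using continuous_map_o_Pair[OF H, of 1] by (simp add: o_def)
  obtain g where g: "continuous_map W X g" "\<And>x. x \<in> topspace X \<Longrightarrow> g (q x) = H (1, x)"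
    by (rule quotient_map_lift_exists[OF quo H1]) (erule (2) fibre1, blast)
  let ?Q = "\<lambda>(t, x). (t, q x)"
  have Qc: "continuous_map (prod_topology ?I X) (prod_topology ?I W) ?Q"
    using continuous_map_compose[OF continuous_map_snd q(1), of ?I]
    unfolding case_prod_unfold o_def by (intro continuous_map_pairedI continuous_map_fst)
  have Qs: "?Q ` topspace (prod_topology ?I X) = topspace (prod_topology ?I W)"
    unfolding topspace_prod_topology q(2)[symmetric] by auto
  \<comment> \<open>A product of a quotient map with the identity need not be a quotient map. Here
    it is one because it is a closed surjection, from a compact space to a Hausdorff space.\<close>
  have quoQ: "quotient_map (prod_topology ?I X) (prod_topology ?I W) ?Q"
    by (rule continuous_closed_imp_quotient_map[OF Qc continuous_imp_closed_map[OF Qc] Qs])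
       (use X W in \<open>simp_all add: compact_space_prod_topology Hausdorff_space_prod_topology
          compact_space_subtopology Hausdorff_space_subtopology\<close>)
  have qH: "continuous_map (prod_topology ?I X) W (\<lambda>z. q (H z))"
    using continuous_map_compose[OF H q(1)] by (simp add: o_def)
  have fib: "q (H z) = q (H z')"
    if "z \<in> topspace (prod_topology ?I X)" "z' \<in> topspace (prod_topology ?I X)" "?Q z = ?Q z'" for z z'
  proof -
    obtain t x t' y where z: "z = (t, x)" "z' = (t', y)" by (cases z; cases z')
    then have "t' = t" "t \<in> {0..1}" "x \<in> topspace X" "y \<in> topspace X" "q x = q y"
      using that by (simp_all add: topspace_prod_topology)
    then show ?thesis using fibre[of t x y] z by simp
  qed
  obtain G where G: "continuous_map (prod_topology ?I W) W G"
      "\<And>z. z \<in> topspace (prod_topology ?I X) \<Longrightarrow> G (?Q z) = q (H z)"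
    by (rule quotient_map_lift_exists[OF quoQ qH]) (erule (2) fib, rule that)
  have h1: "homotopic_with (\<lambda>_. True) X X id (g \<circ> q)"
  proof (subst homotopic_with)
    show "\<exists>h. continuous_map (prod_topology ?I X) X h \<and>
        (\<forall>x\<in>topspace X. h (0, x) = id x) \<and> (\<forall>x\<in>topspace X. h (1, x) = (g \<circ> q) x) \<and> (\<forall>t\<in>{0..1}. True)"
      using H H0 g(2) by (intro exI[of _ H]) simp
  qed simp
  have h2: "homotopic_with (\<lambda>_. True) W W id (q \<circ> g)"
  proof (subst homotopic_with)
    have "G (0, y) = y \<and> G (1, y) = q (g y)" if y: "y \<in> topspace W" for y
    proof -
      obtain x where "x \<in> topspace X" "y = q x" using y q(2) by auto
      then show ?thesis using G(2)[of "(0, x)"] G(2)[of "(1, x)"] H0[of x] g(2)[of x] by simp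
    qed
    then show "\<exists>h. continuous_map (prod_topology ?I W) W h \<and>
        (\<forall>x\<in>topspace W. h (0, x) = id x) \<and> (\<forall>x\<in>topspace W. h (1, x) = (q \<circ> g) x) \<and> (\<forall>t\<in>{0..1}. True)"
      using G(1) by (intro exI[of _ G]) simp
  qed simp
  show ?thesis
    unfolding homotopy_equivalent_space_def
    using q(1) g(1) homotopic_with_symD[OF h1] homotopic_with_symD[OF h2] by blast
qed

lemma continuous_map_from_sum_topology:
  assumes "\<And>i. i \<in> I \<Longrightarrow> continuous_map (X i) Y (\<lambda>x. f (i, x))"
  shows "continuous_map (sum_topology X I) Y f"
  unfolding continuous_map
proof (intro conjI allI impI)
  show "f ` topspace (sum_topology X I) \<subseteq> topspace Y"
    using assms by (fastforce simp: continuous_map_def Pi_iff)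
  fix U assume "openin Y U"
  then have "openin (X i) {x \<in> topspace (X i). f (i, x) \<in> U}" if "i \<in> I" for i
    using assms[OF that] by (simp add: continuous_map_def)
  then show "openin (sum_topology X I) {x \<in> topspace (sum_topology X I). f x \<in> U}"
    by (auto simp: openin_sum_topology)
qed

section \<open>Points and separation in a wedge of spheres\<close>

definition wedge_point :: "nat \<Rightarrow> nat \<Rightarrow> nat \<Rightarrow> (nat \<Rightarrow> real) \<Rightarrow> (nat \<times> (nat \<Rightarrow> real)) set" where
  "wedge_point c m i z = wedge_rel (\<lambda>_. nsphere m) (\<lambda>_. nsphere_base) {..<c} `` {(i, z)}"

lemma wedge_point_eq:
  assumes "i < c" "z \<in> topspace (nsphere m)"
  shows "wedge_point c m i z = (if z = nsphere_base then {..<c} \<times> {nsphere_base} else {(i, z)})"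
  using assms nsphere_base_in_nsphere by (auto simp: wedge_point_def wedge_rel_def)

lemma wedge_point_eq_iff:
  assumes "i < c" "z \<in> topspace (nsphere m)" "j < c" "y \<in> topspace (nsphere m)"
  shows "wedge_point c m i z = wedge_point c m j y \<longleftrightarrow>
    (z = nsphere_base \<and> y = nsphere_base) \<or> (i = j \<and> z = y)"
  using assms by (auto simp: wedge_point_eq)

lemma topspace_wedge_of_spheres:
  "topspace (wedge_of_spheres c m) = (\<Union>i<c. wedge_point c m i ` topspace (nsphere m))"
  by (auto simp: wedge_of_spheres_def wedge_sum_def topspace_quotient_topology quotient_def wedge_point_def)

lemma quotient_map_wedge_of_spheres:
  "quotient_map (sum_topology (\<lambda>_. nsphere m) {..<c}) (wedge_of_spheres c m) (\<lambda>p. wedge_point c m (fst p) (snd p))"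
  unfolding wedge_of_spheres_def wedge_sum_def wedge_point_def prod.collapse
  by (rule quotient_map_quotient_topology)

lemma continuous_map_wedge_point:
  assumes "i < c"
  shows "continuous_map (nsphere m) (wedge_of_spheres c m) (wedge_point c m i)"
  using continuous_map_compose[OF continuous_map_component_injection[of i "{..<c}" "\<lambda>_. nsphere m"]
      quotient_imp_continuous_map[OF quotient_map_wedge_of_spheres[of m c]]] assms
  by (simp add: o_def)

text \<open>A continuous injection into a Hausdorff space is enough. Each sphere is translated so
  that its base point becomes 0 and is placed in its own block of coordinates, so that distinct
  spheres meet only at 0.\<close>

lemma Hausdorff_wedge_of_spheres: "Hausdorff_space (wedge_of_spheres c m)"
proof -
  define f where "f p = (\<lambda>(j, k). if j = fst p then snd p k - nsphere_base k else 0)"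
    for p :: "nat \<times> (nat \<Rightarrow> real)"
  have f_eq: "f (i, z) = f (j, y) \<longleftrightarrow> (z = nsphere_base \<and> y = nsphere_base) \<or> (i = j \<and> z = y)" for i j z y
  proof
    assume eq: "f (i, z) = f (j, y)"
    have fi: "f (i, z) (i, k) = f (j, y) (i, k)" and fj: "f (i, z) (j, k) = f (j, y) (j, k)" for k
      using eq by auto
    show "(z = nsphere_base \<and> y = nsphere_base) \<or> (i = j \<and> z = y)"
    proof (cases "i = j")
      case True
      then have "z k = y k" for k using fi[of k] by (simp add: f_def)
      then show ?thesis using True by blast
    next
      case False
      then have "z k = nsphere_base k" "y k = nsphere_base k" for k
        using fi[of k] fj[of k] by (simp_all add: f_def)
      then show ?thesis by blast
    qed
  qed (auto simp: f_def)
  let ?S = "sum_topology (\<lambda>_. nsphere m) {..<c}"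
  have cont: "continuous_map ?S (powertop_real UNIV) f"
  proof (rule continuous_map_from_sum_topology)
    fix i :: nat
    show "continuous_map (nsphere m) (powertop_real UNIV) (\<lambda>x. f (i, x))"
      unfolding continuous_map_componentwise_UNIV
    proof
      fix p :: "nat \<times> nat"
      show "continuous_map (nsphere m) euclideanreal (\<lambda>x. f (i, x) p)"
        by (cases p; cases "fst p = i")
           (auto simp: f_def nsphere intro!: continuous_map_diff continuous_map_from_subtopology
             continuous_map_product_projection)
    qed
  qed
  have resp: "f p = f p'"
    if "p \<in> topspace ?S" "p' \<in> topspace ?S" "wedge_point c m (fst p) (snd p) = wedge_point c m (fst p') (snd p')"
    for p p'
    using that by (cases p; cases p') (auto simp: f_eq wedge_point_eq_iff)
  obtain g where g: "continuous_map (wedge_of_spheres c m) (powertop_real UNIV) g"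
    "\<And>p. p \<in> topspace ?S \<Longrightarrow> g (wedge_point c m (fst p) (snd p)) = f p"
    by (rule quotient_map_lift_exists[OF quotient_map_wedge_of_spheres cont]) (erule (2) resp, blast)
  have gp: "g (wedge_point c m i z) = f (i, z)" if "i < c" "z \<in> topspace (nsphere m)" for i z
    using g(2)[of "(i, z)"] that by simp
  have "inj_on g (topspace (wedge_of_spheres c m))"
  proof (rule inj_onI)
    fix p p' assume "p \<in> topspace (wedge_of_spheres c m)" "p' \<in> topspace (wedge_of_spheres c m)"
      and eq: "g p = g p'"
    then obtain i z j y where "i < c" "z \<in> topspace (nsphere m)" "p = wedge_point c m i z"
      "j < c" "y \<in> topspace (nsphere m)" "p' = wedge_point c m j y"
      by (auto simp: topspace_wedge_of_spheres)
    then show "p = p'" using eq by (simp add: gp f_eq wedge_point_eq_iff)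
  qed
  then show ?thesis
    by (rule Hausdorff_space_injective_preimage[OF _ g(1), rotated])
       (simp add: Hausdorff_space_product_topology)
qed

section \<open>The sphere as a simplex modulo its boundary\<close>

definition least_coord :: "nat \<Rightarrow> (nat \<Rightarrow> 'v) \<Rightarrow> ('v \<Rightarrow> real) \<Rightarrow> real" where
  "least_coord m e x = Min ((\<lambda>k. x (e k)) ` {..m})"

definition displacement :: "nat \<Rightarrow> (nat \<Rightarrow> 'v) \<Rightarrow> ('v \<Rightarrow> real) \<Rightarrow> nat \<Rightarrow> real" where
  "displacement m e x k = x (e k) - 1 / (real m + 1)"

text \<open>Index 0 is left out because the displacements of a point of the simplex sum to zero; the
  other m are independent coordinates around the barycentre.\<close>

definition displacement_sq :: "nat \<Rightarrow> (nat \<Rightarrow> 'v) \<Rightarrow> ('v \<Rightarrow> real) \<Rightarrow> real" where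
  "displacement_sq m e x = (\<Sum>k=1..m. (displacement m e x k)\<^sup>2)"

text \<open>Inverse stereographic projection of the displacement from the barycentre (in the coordinates
  \<open>1, \<dots>, m\<close>) divided by the least barycentric coordinate; as the latter vanishes exactly on the
  boundary, this realises the sphere as the simplex modulo its boundary.\<close>

definition simplex_to_sphere :: "nat \<Rightarrow> (nat \<Rightarrow> 'v) \<Rightarrow> ('v \<Rightarrow> real) \<Rightarrow> nat \<Rightarrow> real" where
  "simplex_to_sphere m e x k =
     (let s = displacement_sq m e x; l = least_coord m e x
      in if k = 0 then (s - l\<^sup>2) / (s + l\<^sup>2)
         else if k \<le> m then 2 * displacement m e x k * l / (s + l\<^sup>2) else 0)"

context
  fixes m :: nat and e :: "nat \<Rightarrow> 'v" and F :: "'v set"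
  assumes e: "bij_betw e {..m} F"
begin

abbreviation (input) "least \<equiv> least_coord m e"
abbreviation (input) "disp \<equiv> displacement m e"
abbreviation (input) "sqn \<equiv> displacement_sq m e"

lemma sum_simplex: "x \<in> geom_simplex F \<Longrightarrow> (\<Sum>k\<le>m. x (e k)) = 1"
  using sum.reindex_bij_betw[OF e, of x] by (auto simp: geom_simplex_def)

lemma least_le: "k \<le> m \<Longrightarrow> least x \<le> x (e k)"
  by (simp add: least_coord_def)

lemma least_attained: "\<exists>k\<le>m. x (e k) = least x"
proof -
  have "least x \<in> (\<lambda>k. x (e k)) ` {..m}" unfolding least_coord_def by (intro Min_in) auto
  then show ?thesis by force
qed

lemma sum_disp: "x \<in> geom_simplex F \<Longrightarrow> (\<Sum>k\<le>m. disp x k) = 0"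
  by (simp add: displacement_def sum_subtractf sum_simplex)

lemma disp_0: "x \<in> geom_simplex F \<Longrightarrow> disp x 0 = - (\<Sum>k=1..m. disp x k)"
  using sum_disp[of x] by (simp add: atMost_atLeast0 sum.atLeast_Suc_atMost)

lemma sqn_nonneg: "0 \<le> sqn x"
  by (simp add: displacement_sq_def sum_nonneg)

text \<open>Both terms could vanish only at the barycentre, but there the least coordinate is 1 / (m
  + 1).\<close>

lemma denominator_pos:
  assumes "x \<in> geom_simplex F"
  shows "0 < sqn x + (least x)\<^sup>2"
proof (cases "least x = 0")
  case True
  have "sqn x \<noteq> 0"
  proof
    assume "sqn x = 0"
    then have d: "\<forall>k\<in>{1..m}. disp x k = 0"
      unfolding displacement_sq_def by (subst (asm) sum_nonneg_eq_0_iff) auto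
    then have "disp x 0 = 0" using disp_0[OF assms] by simp
    then have d': "disp x k = 0" if "k \<le> m" for k using d that by (cases k) auto
    obtain k where "k \<le> m" "x (e k) = 0" using least_attained[of x] True by auto
    with d'[of k] show False by (simp add: displacement_def)
  qed
  then show ?thesis using sqn_nonneg[of x] True by simp
next
  case False
  then show ?thesis using sqn_nonneg[of x] by (simp add: add_nonneg_pos)
qed

lemma simplex_to_sphere_0: "simplex_to_sphere m e x 0 = (sqn x - (least x)\<^sup>2) / (sqn x + (least x)\<^sup>2)"
  by (simp add: simplex_to_sphere_def Let_def)

lemma simplex_to_sphere_Suc:
  "k \<in> {1..m} \<Longrightarrow> simplex_to_sphere m e x k = 2 * disp x k * least x / (sqn x + (least x)\<^sup>2)"
  by (simp add: simplex_to_sphere_def Let_def)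

lemma simplex_to_sphere_gt: "k > m \<Longrightarrow> simplex_to_sphere m e x k = 0"
  by (simp add: simplex_to_sphere_def Let_def)

text \<open>With y = disp / least, the inverse stereographic projection is ((|y|^2 - 1) / (|y|^2 +
  1), 2y / (|y|^2 + 1)); clearing the denominator least^2 extends it to the boundary of the simplex.
  The norm is 1 by (s - l^2)^2 + 4 s l^2 = (s + l^2)^2.\<close>

lemma simplex_to_sphere_in_nsphere:
  assumes "x \<in> geom_simplex F"
  shows "simplex_to_sphere m e x \<in> topspace (nsphere m)"
proof -
  let ?D = "sqn x + (least x)\<^sup>2"
  have D: "?D \<noteq> 0" using denominator_pos[OF assms] by simp
  have "(\<Sum>k\<le>m. (simplex_to_sphere m e x k)\<^sup>2)
      = (simplex_to_sphere m e x 0)\<^sup>2 + (\<Sum>k=1..m. (simplex_to_sphere m e x k)\<^sup>2)"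
    by (simp add: atMost_atLeast0 sum.atLeast_Suc_atMost)
  also have "(\<Sum>k=1..m. (simplex_to_sphere m e x k)\<^sup>2) = (\<Sum>k=1..m. (disp x k)\<^sup>2 * (4 * (least x)\<^sup>2 / ?D\<^sup>2))"
    by (intro sum.cong refl, subst simplex_to_sphere_Suc) (auto simp: power_divide power_mult_distrib)
  also have "\<dots> = sqn x * (4 * (least x)\<^sup>2 / ?D\<^sup>2)"
    by (simp only: sum_distrib_right displacement_sq_def)
  also have "(simplex_to_sphere m e x 0)\<^sup>2 + \<dots> = ((sqn x - (least x)\<^sup>2)\<^sup>2 + 4 * sqn x * (least x)\<^sup>2) / ?D\<^sup>2"
    by (simp add: simplex_to_sphere_0 power_divide add_divide_distrib)
  also have "(sqn x - (least x)\<^sup>2)\<^sup>2 + 4 * sqn x * (least x)\<^sup>2 = ?D\<^sup>2"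
    by (simp add: power2_eq_square algebra_simps)
  finally show ?thesis using D
    by (simp add: nsphere simplex_to_sphere_gt)
qed

lemma simplex_to_sphere_eq_base_iff:
  assumes "x \<in> geom_simplex F"
  shows "simplex_to_sphere m e x = nsphere_base \<longleftrightarrow> least x = 0"
proof
  assume "simplex_to_sphere m e x = nsphere_base"
  then have "simplex_to_sphere m e x 0 = 1" by (simp add: nsphere_base_def)
  then show "least x = 0" using denominator_pos[OF assms] by (simp add: simplex_to_sphere_0)
next
  assume l: "least x = 0"
  have D: "sqn x \<noteq> 0" using denominator_pos[OF assms] l by simp
  show "simplex_to_sphere m e x = nsphere_base"
  proof
    fix k
    consider "k = 0" | "k \<in> {1..m}" | "k > m" by force
    then show "simplex_to_sphere m e x k = nsphere_base k"
      by cases (use l D in \<open>auto simp: simplex_to_sphere_def Let_def nsphere_base_def\<close>)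
  qed
qed

text \<open>The right-hand side is the stereographic projection from \<open>nsphere_base\<close>, so
  the ratios can be read off from the image point.\<close>

lemma disp_over_least:
  assumes x: "x \<in> geom_simplex F" and "least x > 0" "k \<in> {1..m}"
  shows "disp x k / least x = simplex_to_sphere m e x k / (1 - simplex_to_sphere m e x 0)"
proof -
  let ?D = "sqn x + (least x)\<^sup>2"
  have D: "?D \<noteq> 0" using denominator_pos[OF x] by simp
  then have "1 - simplex_to_sphere m e x 0 = 2 * (least x)\<^sup>2 / ?D"
    unfolding simplex_to_sphere_0 by (subst diff_divide_eq_iff) (auto simp: field_simps)
  then show ?thesis
    unfolding simplex_to_sphere_Suc[OF assms(3)] using D assms(2) by (simp add: power2_eq_square)
qed

text \<open>The image determines all ratios of displacement to least coordinate, the one at index 0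
  through the zero sum. What remains is the scale, that is, the least coordinate itself.\<close>

lemma simplex_to_sphere_inj_interior:
  assumes x: "x \<in> geom_simplex F" "least x > 0" and y: "y \<in> geom_simplex F" "least y > 0"
    and eq: "simplex_to_sphere m e x = simplex_to_sphere m e y"
  shows "x = y"
proof -
  have *: "disp x k / least x = disp y k / least y" if "k \<in> {1..m}" for k
    using disp_over_least[OF x that] disp_over_least[OF y that] eq by simp
  have "disp x 0 / least x = - (\<Sum>k=1..m. disp x k / least x)"
    by (simp add: disp_0[OF x(1)] sum_divide_distrib)
  also have "\<dots> = - (\<Sum>k=1..m. disp y k / least y)" using * by simp
  also have "\<dots> = disp y 0 / least y"
    by (simp add: disp_0[OF y(1)] sum_divide_distrib)
  finally have r: "disp x k / least x = disp y k / least y" if "k \<le> m" for k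
    using * that by (cases "k = 0") auto
  \<comment> \<open>Equal ratios are compared at an index where x is least; there y is at least its
    own minimum. By symmetry the two minima agree.\<close>
  have le: "least y \<le> least x"
    if x: "least x > 0" and y: "least y > 0" and r: "\<And>k. k \<le> m \<Longrightarrow> disp x k / least x = disp y k / least y"
    for x y
  proof -
    obtain k where k: "k \<le> m" "x (e k) = least x" using least_attained by blast
    have "least x * disp y k = least y * (least x - 1 / (real m + 1))"
    proof -
      have "disp x k = least x - 1 / (real m + 1)" by (simp add: displacement_def k(2))
      then show ?thesis using r[OF k(1)] x y by (simp add: frac_eq_eq mult.commute)
    qed
    moreover have "least x * disp y k \<ge> least x * (least y - 1 / (real m + 1))"
      using least_le[OF k(1), of y] x by (intro mult_left_mono) (auto simp: displacement_def)
    ultimately have "least y * (1 / (real m + 1)) \<le> least x * (1 / (real m + 1))"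
      by (simp only: right_diff_distrib) (simp add: mult.commute)
    then show ?thesis by (simp add: divide_le_cancel)
  qed
  have "least x = least y" using le[OF x(2) y(2) r] le[OF y(2) x(2) r[symmetric]] by simp
  then have "x (e k) = y (e k)" if "k \<le> m" for k
    using r[OF that] x(2) by (simp add: displacement_def)
  moreover have "x v = 0 \<and> y v = 0" if "v \<notin> F" for v using that x y by (auto simp: geom_simplex_def)
  moreover have "\<exists>k\<le>m. v = e k" if "v \<in> F" for v using that e by (auto simp: bij_betw_def)
  ultimately show ?thesis by (intro ext) metis
qed

lemma simplex_to_sphere_surj:
  assumes z: "z \<in> topspace (nsphere m)" "z \<noteq> nsphere_base"
  shows "\<exists>x\<in>geom_simplex F. least x > 0 \<and> simplex_to_sphere m e x = z"
proof -
  have z2: "(z 0)\<^sup>2 + (\<Sum>k=1..m. (z k)\<^sup>2) = 1" and zm: "\<And>k. k > m \<Longrightarrow> z k = 0"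
    using z(1) by (auto simp: nsphere atMost_atLeast0 sum.atLeast_Suc_atMost)
  have z0: "z 0 < 1"
  proof (rule ccontr)
    assume "\<not> z 0 < 1"
    then have "(z 0)\<^sup>2 \<ge> 1" by (simp add: one_le_power)
    moreover have "(\<Sum>k=1..m. (z k)\<^sup>2) \<ge> 0" by (simp add: sum_nonneg)
    ultimately have "(\<Sum>k=1..m. (z k)\<^sup>2) = 0" "(z 0)\<^sup>2 = 1" using z2 by linarith+
    then have 1: "\<forall>k\<in>{1..m}. z k = 0" and 2: "z 0 = 1"
      using \<open>\<not> z 0 < 1\<close> by (auto simp: sum_nonneg_eq_0_iff power2_eq_1_iff)
    have "z k = nsphere_base k" for k
      using 1 2 zm by (cases "k \<le> m") (auto simp: nsphere_base_def)
    then have "z = nsphere_base" by blast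
    then show False using z by simp
  qed
  \<comment> \<open>These are the stereographic coordinates of z, with \<open>u 0\<close> chosen to
    make the sum zero, so that moving along \<open>u\<close> from the barycentre keeps the total
    mass 1. Hence also the minimum \<open>p\<close> is at most 0.\<close>
  define u where "u k = (if k = 0 then - (\<Sum>k=1..m. z k / (1 - z 0)) else z k / (1 - z 0))" for k
  have usum: "(\<Sum>k\<le>m. u k) = 0"
    by (simp add: atMost_atLeast0 sum.atLeast_Suc_atMost u_def)
  define p where "p = Min (u ` {..m})"
  have p_le: "p \<le> u k" if "k \<le> m" for k using that by (simp add: p_def)
  have "p \<in> u ` {..m}" unfolding p_def by (intro Min_in) auto
  then obtain k0 where k0: "k0 \<le> m" "u k0 = p" by auto
  have "(real m + 1) * p \<le> (\<Sum>k\<le>m. u k)"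
    using sum_bounded_below[of "{..m}" p u] p_le by (simp add: add.commute)
  then have "p \<le> 0" using usum by (simp add: mult_le_0_iff)
  \<comment> \<open>The solution of 1 / (m + 1) + \<mu> p = \<mu>: the least coordinate of the point
    at displacement \<mu> u is then \<mu> itself, and its ratios are exactly
    \<open>u\<close>.\<close>
  define \<mu> where "\<mu> = 1 / ((real m + 1) * (1 - p))"
  have \<mu>: "\<mu> > 0" using \<open>p \<le> 0\<close> by (simp add: \<mu>_def)
  have \<mu>p: "1 / (real m + 1) + \<mu> * p = \<mu>"
  proof -
    have "\<mu> * (1 - p) = 1 / (real m + 1)" using \<open>p \<le> 0\<close> by (simp add: \<mu>_def)
    then show ?thesis by (simp add: algebra_simps)
  qed
  define x where "x v = (if v \<in> F then 1 / (real m + 1) + \<mu> * u (inv_into {..m} e v) else 0)" for v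
  have xe: "x (e k) = 1 / (real m + 1) + \<mu> * u k" if "k \<le> m" for k
    using that e by (auto simp: x_def bij_betw_def)
  have ge: "\<mu> \<le> x (e k)" if "k \<le> m" for k
    using xe[OF that] \<mu>p p_le[OF that] \<mu> mult_left_mono[of p "u k" \<mu>] by linarith
  have least: "least x = \<mu>"
    unfolding least_coord_def
  proof (rule Min_eqI)
    show "\<mu> \<in> (\<lambda>k. x (e k)) ` {..m}" using k0 xe[OF k0(1)] \<mu>p by (auto intro!: image_eqI[of _ _ k0])
  qed (use ge in auto)
  have "(\<Sum>v\<in>F. x v) = (\<Sum>k\<le>m. x (e k))" using sum.reindex_bij_betw[OF e, of x] by simp
  also have "\<dots> = (\<Sum>k\<le>m. 1 / (real m + 1) + \<mu> * u k)" by (intro sum.cong) (auto simp: xe)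
  also have "\<dots> = 1" using usum by (simp add: sum.distrib flip: sum_distrib_left)
  finally have "(\<Sum>v\<in>F. x v) = 1" .
  moreover have "0 \<le> x v" for v
  proof (cases "v \<in> F")
    case True
    then obtain k where "k \<le> m" "v = e k" using e by (auto simp: bij_betw_def)
    then show ?thesis using ge \<mu> by force
  qed (simp add: x_def)
  ultimately have xF: "x \<in> geom_simplex F" by (auto simp: geom_simplex_def x_def)
  have "simplex_to_sphere m e x = z"
  proof
    fix k
    define U where "U = (\<Sum>k=1..m. (u k)\<^sup>2)"
    have "U = (\<Sum>k=1..m. (z k)\<^sup>2) / (1 - z 0)\<^sup>2"
      by (simp add: U_def u_def power_divide sum_divide_distrib)
    also have "\<dots> = ((1 - z 0) * (1 + z 0)) / (1 - z 0)\<^sup>2"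
      using z2 by (simp add: power2_eq_square algebra_simps)
    also have "\<dots> = (1 + z 0) / (1 - z 0)" using z0 by (simp add: power2_eq_square)
    finally have U: "U = (1 + z 0) / (1 - z 0)" .
    have U1: "U + 1 = 2 / (1 - z 0)" "U - 1 = 2 * z 0 / (1 - z 0)" using z0 unfolding U by (simp_all add: field_simps)
    have d: "disp x k = \<mu> * u k" if "k \<le> m" for k using xe[OF that] by (simp add: displacement_def)
    have s: "sqn x = \<mu>\<^sup>2 * U"
      unfolding U_def sum_distrib_left displacement_sq_def by (intro sum.cong) (simp_all add: d power_mult_distrib)
    have D: "sqn x + (least x)\<^sup>2 = \<mu>\<^sup>2 * (U + 1)" "sqn x - (least x)\<^sup>2 = \<mu>\<^sup>2 * (U - 1)"
      unfolding s least by (simp_all add: algebra_simps)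
    consider "k = 0" | "k \<in> {1..m}" | "k > m" by force
    then show "simplex_to_sphere m e x k = z k"
    proof cases
      case 1
      then show ?thesis unfolding 1 simplex_to_sphere_0 D U1 using \<mu> z0 by simp
    next
      case 2
      then show ?thesis
        unfolding simplex_to_sphere_Suc[OF 2] D U1 unfolding least using \<mu> z0 d[of k]
        by (simp add: u_def power2_eq_square)
    next
      case 3
      then show ?thesis by (simp add: simplex_to_sphere_gt zm)
    qed
  qed
  then show ?thesis using xF least \<mu> by auto
qed

lemma continuous_on_simplex_to_sphere: "continuous_on (geom_simplex F) (simplex_to_sphere m e)"
proof (rule continuous_on_coordinatewise_then_product)
  fix k
  have c: "continuous_on (geom_simplex F) (\<lambda>x. x (e k))" for k
    by (rule continuous_on_coord[OF continuous_on_id])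
  have l: "continuous_on (geom_simplex F) (\<lambda>x. least x)"
    unfolding least_coord_def by (rule continuous_on_Min_image) (auto intro: c)
  have d: "continuous_on (geom_simplex F) (\<lambda>x. disp x k)" for k
    unfolding displacement_def by (intro continuous_on_diff continuous_on_const c)
  have s: "continuous_on (geom_simplex F) (\<lambda>x. sqn x)"
    unfolding displacement_sq_def by (intro continuous_on_sum continuous_on_power d)
  have D: "\<forall>x\<in>geom_simplex F. sqn x + (least x)\<^sup>2 \<noteq> 0" using denominator_pos by force
  consider "k = 0" | "k \<in> {1..m}" | "k > m" by force
  then show "continuous_on (geom_simplex F) (\<lambda>x. simplex_to_sphere m e x k)"
  proof cases
    case 1
    show ?thesis unfolding 1 simplex_to_sphere_0
      by (intro continuous_on_divide continuous_on_diff continuous_on_add continuous_on_power l s D)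
  next
    case 2
    show ?thesis unfolding simplex_to_sphere_Suc[OF 2]
      by (intro continuous_on_divide continuous_on_diff continuous_on_add continuous_on_mult
          continuous_on_const continuous_on_power d l s D)
  qed (simp add: simplex_to_sphere_gt)
qed

end

section \<open>Attaching facets to a contractible complex\<close>

text \<open>Each \<open>F i\<close> lies outside L while its nonempty proper faces lie in L, so
  attaching it adds only an open simplex. At least one facet is demanded because
  \<open>wedge_of_spheres 0 m\<close> is empty and not a point.\<close>

locale facet_attachment =
  fixes L :: "'v set set" and F :: "nat \<Rightarrow> 'v set" and e :: "nat \<Rightarrow> nat \<Rightarrow> 'v" and c m :: nat
  assumes finite_L: "finite L"
    and finite_simplex: "\<And>\<rho>. \<rho> \<in> L \<Longrightarrow> finite \<rho>"
    and down: "\<And>\<rho> \<tau>. \<rho> \<in> L \<Longrightarrow> \<tau> \<subseteq> \<rho> \<Longrightarrow> \<tau> \<noteq> {} \<Longrightarrow> \<tau> \<in> L"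
    and bij: "\<And>i. i < c \<Longrightarrow> bij_betw (e i) {..m} (F i)"
    and not_in_L: "\<And>i. i < c \<Longrightarrow> F i \<notin> L"
    and boundary: "\<And>i \<rho>. i < c \<Longrightarrow> \<rho> \<subset> F i \<Longrightarrow> \<rho> \<noteq> {} \<Longrightarrow> \<rho> \<in> L"
    and inj: "inj_on F {..<c}"
    and c_pos: "0 < c"
    and L_nonempty: "underlying_space L \<noteq> {}"
    and L_contractible: "contractible (underlying_space L)"
begin

definition "X = underlying_space (L \<union> F ` {..<c})"
definition "A = underlying_space L"
definition "\<mu> i x = least_coord m (e i) x"
definition "barycentre i v = (if v \<in> F i then 1 / (real m + 1) else 0)"

lemma F_fin: "i < c \<Longrightarrow> finite (F i)" and F_card: "i < c \<Longrightarrow> card (F i) = m + 1"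
  using bij bij_betw_finite bij_betw_same_card[OF bij] by fastforce+

lemma F_ne: "i < c \<Longrightarrow> F i \<noteq> {}"
  using F_card by force

lemma fin: "\<rho> \<in> L \<union> F ` {..<c} \<Longrightarrow> finite \<rho>"
  using finite_simplex F_fin by auto

lemma A_subset_X: "A \<subseteq> X"
  by (auto simp: A_def X_def underlying_space_def)

lemma closed_A: "closed A" and closed_X: "closed X" and compact_X: "compact X"
  unfolding A_def X_def using finite_L fin
  by (auto intro!: closed_underlying_space compact_underlying_space)

lemma X_nonneg: "x \<in> X \<Longrightarrow> 0 \<le> x v"
  by (auto simp: X_def underlying_space_def geom_simplex_def)

lemma \<mu>_le: "i < c \<Longrightarrow> v \<in> F i \<Longrightarrow> \<mu> i x \<le> x v"
  using bij[of i] least_le[OF bij, of i _ x] by (force simp: \<mu>_def bij_betw_def)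

lemma \<mu>_attained: "i < c \<Longrightarrow> \<exists>v\<in>F i. x v = \<mu> i x"
  using bij[of i] least_attained[OF bij, of i x] by (force simp: \<mu>_def bij_betw_def)

lemma \<mu>_nonneg: "i < c \<Longrightarrow> x \<in> X \<Longrightarrow> 0 \<le> \<mu> i x"
  using \<mu>_attained[of i x] X_nonneg[of x] by metis

text \<open>A simplex of L above \<open>F i\<close> would put \<open>F i\<close> into L by closure
  under faces, and a strictly larger \<open>F j\<close> would do so through
  \<open>boundary\<close>.\<close>

lemma F_subset_eq:
  assumes "i < c" "\<rho> \<in> L \<union> F ` {..<c}" "F i \<subseteq> \<rho>"
  shows "\<rho> = F i"
  using assms not_in_L down boundary F_ne by (metis UnE imageE lessThan_iff psubsetI)

text \<open>Positive coordinates on all of \<open>F i\<close> force every simplex carrying x to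
  contain \<open>F i\<close>, and \<open>F i\<close> is maximal.\<close>

lemma \<mu>_pos_simplex:
  assumes "i < c" "x \<in> X" "0 < \<mu> i x"
  shows "x \<in> geom_simplex (F i)"
proof -
  obtain \<rho> where \<rho>: "\<rho> \<in> L \<union> F ` {..<c}" "x \<in> geom_simplex \<rho>"
    using assms by (auto simp: X_def underlying_space_def)
  have "v \<in> \<rho>" if "v \<in> F i" for v
    using \<mu>_le[OF assms(1) that, of x] assms(3) \<rho>(2) by (force simp: geom_simplex_def)
  then show ?thesis using F_subset_eq[OF assms(1) \<rho>(1)] \<rho>(2) by auto
qed

lemma \<mu>_pos_unique:
  assumes "i < c" "j < c" "x \<in> X" "0 < \<mu> i x" "0 < \<mu> j x"
  shows "i = j"
proof -
  have "v \<in> F j" if "v \<in> F i" for v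
    using \<mu>_le[OF assms(1) that, of x] assms(4) \<mu>_pos_simplex[OF assms(2,3,5)]
    by (force simp: geom_simplex_def)
  then have "F j = F i" using F_subset_eq[of i "F j"] assms by auto
  then show ?thesis using inj assms by (auto simp: inj_on_def)
qed

lemma \<mu>_A: "i < c \<Longrightarrow> x \<in> A \<Longrightarrow> \<mu> i x = 0"
proof (rule ccontr)
  assume i: "i < c" and x: "x \<in> A" and "\<mu> i x \<noteq> 0"
  then have pos: "0 < \<mu> i x" using \<mu>_nonneg[of i x] A_subset_X by fastforce
  obtain \<rho> where \<rho>: "\<rho> \<in> L" "x \<in> geom_simplex \<rho>" using x by (auto simp: A_def underlying_space_def)
  have "v \<in> \<rho>" if "v \<in> F i" for v
    using \<mu>_le[OF i that, of x] pos \<rho>(2) by (force simp: geom_simplex_def)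
  then show False using down[OF \<rho>(1), of "F i"] F_ne[OF i] not_in_L[OF i] by blast
qed

lemma simplex_boundary_A:
  assumes i: "i < c" and x: "x \<in> geom_simplex (F i)" and "\<mu> i x = 0"
  shows "x \<in> A"
proof -
  obtain v where v: "v \<in> F i" "x v = 0" using \<mu>_attained[OF i] assms(3) by metis
  have *: "x \<in> geom_simplex (F i - {v})"
    by (rule geom_simplex_face[OF x F_fin[OF i]]) (use v in auto)
  have "F i - {v} \<noteq> {}"
  proof
    assume eq: "F i - {v} = {}"
    have "x \<in> geom_simplex {}" using * unfolding eq .
    then show False by (simp add: geom_simplex_def)
  qed
  then have "F i - {v} \<in> L" using boundary[OF i, of "F i - {v}"] v by blast
  then show ?thesis using * by (auto simp: A_def underlying_space_def)
qed

lemma in_A_iff: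
  assumes "x \<in> X"
  shows "x \<in> A \<longleftrightarrow> (\<forall>i<c. \<mu> i x = 0)"
proof
  assume r: "\<forall>i<c. \<mu> i x = 0"
  show "x \<in> A"
    using assms r simplex_boundary_A[of _ x] by (auto simp: X_def A_def underlying_space_def)
qed (use \<mu>_A in auto)

lemma X_cases:
  assumes "x \<in> X"
  obtains "x \<in> A" "\<And>i. i < c \<Longrightarrow> \<mu> i x = 0"
  | i where "i < c" "0 < \<mu> i x" "x \<in> geom_simplex (F i)" "\<forall>j<c. j \<noteq> i \<longrightarrow> \<mu> j x = 0"
proof (cases "x \<in> A")
  case True
  then show ?thesis using that(1) \<mu>_A by blast
next
  case False
  then obtain i where i: "i < c" "0 < \<mu> i x" using in_A_iff[OF assms] \<mu>_nonneg[OF _ assms] by force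
  have "\<mu> j x = 0" if "j < c" "j \<noteq> i" for j
    using \<mu>_pos_unique[OF i(1) that(1) assms i(2)] that(2) \<mu>_nonneg[OF that(1) assms] by force
  then show ?thesis using that(2) i \<mu>_pos_simplex[OF i(1) assms i(2)] by blast
qed

lemma continuous_\<mu>: "continuous_on S (\<mu> i)"
  unfolding \<mu>_def least_coord_def
  by (intro continuous_on_Min_image continuous_on_coord[OF continuous_on_id]) auto

text \<open>Dilation of the facets from their barycentres by the factor \<open>1 + t\<close>, stopped at the boundary.
  The time left after hitting the boundary is spent on contracting \<open>A\<close>.\<close>

definition "dilation t i x = 1 / max (1 / (1 + t)) (1 - (real m + 1) * \<mu> i x)"

text \<open>At a point of X at most one summand is nonzero, since \<open>dilation\<close> is 1
  wherever \<mu> i vanishes. Summing over all facets gives one formula, continuous on X without any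
  case distinction.\<close>

definition "push z = (\<lambda>v. snd z v + (\<Sum>i<c. (dilation (fst z) i (snd z) - 1) * (snd z v - barycentre i v)))"

text \<open>With s = 1 - (m + 1) \<mu>, dilation by 1 + t passes the boundary when (1 + t) s exceeds
  1. The excess is the time left; it equals t on A.\<close>

definition "time_left z = max 0 ((1 + fst z) * (1 - (real m + 1) * (\<Sum>i<c. \<mu> i (snd z))) - 1)"

lemma dilation_boundary: "0 \<le> t \<Longrightarrow> \<mu> i x = 0 \<Longrightarrow> dilation t i x = 1"
  by (simp add: dilation_def max_def)

lemma push_A:
  assumes "x \<in> A" "0 \<le> t" "t \<le> 1"
  shows "push (t, x) = x" "time_left (t, x) = t"
  using assms \<mu>_A by (simp_all add: push_def time_left_def dilation_boundary)

lemma push_simplex: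
  assumes i: "i < c" "\<forall>j<c. j \<noteq> i \<longrightarrow> \<mu> j x = 0" and t: "0 \<le> t"
  shows "push (t, x) = (\<lambda>v. dilation t i x * x v + (1 - dilation t i x) * barycentre i v)"
    and "time_left (t, x) = max 0 ((1 + t) * (1 - (real m + 1) * \<mu> i x) - 1)"
proof -
  have "(\<Sum>j<c. (dilation t j x - 1) * (x v - barycentre j v)) = (dilation t i x - 1) * (x v - barycentre i v)" for v
    using i t by (subst sum.remove[of _ i]) (auto simp: dilation_boundary intro!: sum.neutral)
  then show "push (t, x) = (\<lambda>v. dilation t i x * x v + (1 - dilation t i x) * barycentre i v)"
    by (auto simp: push_def algebra_simps)
  have "(\<Sum>j<c. \<mu> j x) = \<mu> i x"
    using i by (subst sum.remove[of _ i]) (auto intro!: sum.neutral)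
  then show "time_left (t, x) = max 0 ((1 + t) * (1 - (real m + 1) * \<mu> i x) - 1)"
    by (simp add: time_left_def)
qed

lemma push_in_simplex:
  assumes i: "i < c" "\<forall>j<c. j \<noteq> i \<longrightarrow> \<mu> j x = 0" and x: "x \<in> geom_simplex (F i)" and t: "0 \<le> t"
  shows "push (t, x) \<in> geom_simplex (F i)"
    and "time_left (t, x) > 0 \<Longrightarrow> push (t, x) \<in> A"
proof -
  \<comment> \<open>\<open>s\<close> is the gauge of the simplex about its barycentre, 0 at the
    barycentre and 1 on the boundary. Thus \<open>dilation\<close> is the smaller of 1 + t and 1 /
    s, written with a maximum because s may be 0.\<close>
  define s where "s = 1 - (real m + 1) * \<mu> i x"
  define d where "d = dilation t i x"
  have d: "d = 1 / max (1 / (1 + t)) s" by (simp add: d_def dilation_def s_def)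
  have mx: "0 < max (1 / (1 + t)) s" using t by (simp add: less_max_iff_disj)
  have "s \<le> max (1 / (1 + t)) s" by simp
  then have ds: "d * s \<le> 1" unfolding d using mx by (simp add: field_simps)
  have d0: "0 < d" unfolding d using mx by simp
  note p = push_simplex(1)[OF i t, folded d_def]
  \<comment> \<open>Both sides are the least coordinate after dilation by d; it is nonnegative
    because d * s is at most 1.\<close>
  have low: "d * \<mu> i x + (1 - d) / (real m + 1) = (1 - d * s) / (real m + 1)"
    by (simp add: s_def field_simps)
  have "0 \<le> push (t, x) v" for v
  proof (cases "v \<in> F i")
    case True
    have "0 \<le> (1 - d * s) / (real m + 1)" using ds by simp
    also have "\<dots> \<le> push (t, x) v"
      unfolding p low[symmetric] using \<mu>_le[OF i(1) True, of x] d0 True by (simp add: barycentre_def)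
    finally show ?thesis .
  next
    case False
    then show ?thesis using x by (simp add: p barycentre_def geom_simplex_def)
  qed
  moreover have "push (t, x) v = 0" if "v \<notin> F i" for v
    using that x by (simp add: p barycentre_def geom_simplex_def)
  moreover have "(\<Sum>v\<in>F i. push (t, x) v) = 1"
  proof -
    have "(\<Sum>v\<in>F i. push (t, x) v) = d * (\<Sum>v\<in>F i. x v) + (1 - d) * (\<Sum>v\<in>F i. barycentre i v)"
      by (simp add: p sum.distrib sum_distrib_left)
    also have "(\<Sum>v\<in>F i. barycentre i v) = 1" using F_card[OF i(1)] by (simp add: barycentre_def add.commute)
    also have "(\<Sum>v\<in>F i. x v) = 1" using x by (simp add: geom_simplex_def)
    finally show ?thesis by simp
  qed
  ultimately show P: "push (t, x) \<in> geom_simplex (F i)" by (auto simp: geom_simplex_def)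
  assume "time_left (t, x) > 0"
  then have "(1 + t) * s > 1" using push_simplex(2)[OF i t] by (simp add: s_def)
  then have "s > 1 / (1 + t)" using t by (simp add: field_simps)
  \<comment> \<open>Time is left only if the dilation was stopped at 1 / s; then the least
    coordinate has become 0 and the point lies on the boundary.\<close>
  then have "d * s = 1" unfolding d using t by (simp add: max_def) (smt (verit) divide_nonneg_nonneg)
  obtain v where v: "v \<in> F i" "x v = \<mu> i x" using \<mu>_attained[OF i(1)] by blast
  have "push (t, x) v = (1 - d * s) / (real m + 1)"
    unfolding low[symmetric] p using v by (simp add: barycentre_def)
  then have "push (t, x) v = 0" using \<open>d * s = 1\<close> by simp
  then have "\<mu> i (push (t, x)) \<le> 0" using \<mu>_le[OF i(1) v(1)] by metis
  moreover have "0 \<le> \<mu> i (push (t, x))"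
  proof -
    obtain u where "push (t, x) u = \<mu> i (push (t, x))" using \<mu>_attained[OF i(1)] by blast
    moreover have "0 \<le> push (t, x) u" using P by (simp add: geom_simplex_def)
    ultimately show ?thesis by simp
  qed
  ultimately show "push (t, x) \<in> A" using simplex_boundary_A[OF i(1) P] by simp
qed

lemma push_in_X:
  assumes "x \<in> X" "0 \<le> t" "t \<le> 1"
  shows "push (t, x) \<in> X" "time_left (t, x) > 0 \<Longrightarrow> push (t, x) \<in> A" "time_left (t, x) \<in> {0..1}"
proof -
  have X: "geom_simplex (F i) \<subseteq> X" if "i < c" for i
    using that by (auto simp: X_def underlying_space_def)
  show "push (t, x) \<in> X"
    using assms(1)
  proof (cases rule: X_cases)
    case 1
    then show ?thesis using push_A(1)[OF 1(1) assms(2,3)] assms(1) by simp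
  next
    case (2 i)
    then show ?thesis using push_in_simplex(1)[OF 2(1,4,3) assms(2)] X by blast
  qed
  show "time_left (t, x) > 0 \<Longrightarrow> push (t, x) \<in> A"
    using assms(1)
  proof (cases rule: X_cases)
    case 1
    then show ?thesis using push_A(1)[OF 1(1) assms(2,3)] by simp
  next
    case (2 i)
    assume "time_left (t, x) > 0"
    then show ?thesis using push_in_simplex(2)[OF 2(1,4,3) assms(2)] by blast
  qed
  have "0 \<le> (\<Sum>i<c. \<mu> i x)" using \<mu>_nonneg assms by (intro sum_nonneg) auto
  then have u: "0 \<le> (1 + t) * ((real m + 1) * (\<Sum>i<c. \<mu> i x))" (is "0 \<le> (1 + t) * ?u") using assms by simp
  have "(1 + t) * (1 - ?u) = 1 + t - (1 + t) * ?u" by (simp add: right_diff_distrib)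
  then have "(1 + t) * (1 - ?u) - 1 \<le> 1" using assms u by linarith
  then show "time_left (t, x) \<in> {0..1}" by (simp add: time_left_def)
qed

lemma continuous_push: "continuous_on ({0..1} \<times> X) push" and continuous_time_left: "continuous_on ({0..1} \<times> X) time_left"
proof -
  let ?S = "{0..1::real} \<times> X"
  have \<mu>: "continuous_on ?S (\<lambda>z. \<mu> i (snd z))" for i
    by (rule continuous_on_compose2[OF continuous_\<mu>[of UNIV] continuous_on_snd[OF continuous_on_id]]) auto
  have x: "continuous_on ?S (\<lambda>z. snd z v)" for v
    by (rule continuous_on_coord[OF continuous_on_snd[OF continuous_on_id]])
  have s: "continuous_on ?S (\<lambda>z. 1 - (real m + 1) * \<mu> i (snd z))" for i
    by (intro continuous_on_diff continuous_on_mult continuous_on_const \<mu>)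
  have "continuous_on ?S (\<lambda>z. 1 / (1 + fst z))"
    by (rule continuous_on_divide[OF continuous_on_const continuous_on_add[OF continuous_on_const
          continuous_on_fst[OF continuous_on_id]]]) auto
  then have m: "continuous_on ?S (\<lambda>z. max (1 / (1 + fst z)) (1 - (real m + 1) * \<mu> i (snd z)))" for i
    by (intro continuous_on_max s)
  have d: "continuous_on ?S (\<lambda>z. dilation (fst z) i (snd z))" for i
    unfolding dilation_def
    by (intro continuous_on_divide continuous_on_const m) (auto simp: max_def split: if_splits)
  show "continuous_on ?S push"
    unfolding push_def
    by (intro continuous_on_coordinatewise_then_product continuous_on_add continuous_on_sum
        continuous_on_mult continuous_on_diff continuous_on_const d x)
  show "continuous_on ?S time_left"
    unfolding time_left_def
    by (intro continuous_on_max continuous_on_add continuous_on_sum continuous_on_fst continuous_on_id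
        continuous_on_mult continuous_on_diff continuous_on_const \<mu>)
qed

text \<open>This is homotopy extension by hand: \<open>push\<close> is followed by the contraction
  \<open>h\<close> of A, run for the time left. The two pieces live on the closed sets where no time
  is left and where \<open>push\<close> lands in A; on the overlap they agree because
  \<open>h\<close> starts at the identity.\<close>

lemma contraction_extension:
  obtains H a where "continuous_on ({0..1::real} \<times> X) H" "H ` ({0..1} \<times> X) \<subseteq> X"
    "\<And>x. x \<in> X \<Longrightarrow> H (0, x) = x"
    "\<And>t x. t \<in> {0..1} \<Longrightarrow> x \<in> A \<Longrightarrow> H (t, x) \<in> A"
    "\<And>x. x \<in> A \<Longrightarrow> H (1, x) = a"
proof -
  obtain a where "homotopic_with_canon (\<lambda>_. True) A A id (\<lambda>_. a)"
    using L_contractible by (auto simp: contractible_def A_def)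
  then obtain h where ch: "continuous_map (prod_topology (top_of_set {0..1::real}) (top_of_set A)) (top_of_set A) h"
    and h01: "\<forall>x. h (0, x) = id x" "\<forall>x. h (1, x) = a"
    unfolding homotopic_with_def by blast
  have h0: "h (0, x) = x" and h1: "h (1, x) = a" for x using h01 by simp_all
  have "continuous_on ({0..1} \<times> A) h \<and> h \<in> {0..1} \<times> A \<rightarrow> A" using ch by simp
  then have h: "continuous_on ({0..1} \<times> A) h" "h ` ({0..1} \<times> A) \<subseteq> A"
    by (simp_all only: image_subset_iff_funcset)
  let ?S = "{0..1::real} \<times> X"
  define H where "H z = (if time_left z = 0 then push z else h (time_left z, push z))" for z
  let ?C = "{z \<in> ?S. time_left z = 0}" and ?D = "{z \<in> ?S. push z \<in> A}"
  have S: "closed ?S" using closed_X by (intro closed_Times) auto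
  have C: "closed ?C"
    using continuous_closed_preimage[OF continuous_time_left S, of "{0}"] by (simp add: vimage_def Int_def)
  have D: "closed ?D"
    using continuous_closed_preimage[OF continuous_push S closed_A] by (simp add: vimage_def Int_def)
  have push_mem: "push z \<in> X" "time_left z > 0 \<Longrightarrow> push z \<in> A" "time_left z \<in> {0..1}" if "z \<in> ?S" for z
    using that push_in_X[of "snd z" "fst z"] by auto
  have CD: "?S = ?C \<union> ?D" using push_mem by fastforce
  have "continuous_on (?C \<union> ?D) H"
    unfolding H_def
  proof (rule continuous_on_cases[OF C D])
    show "continuous_on ?C push" by (rule continuous_on_subset[OF continuous_push]) auto
    show "continuous_on ?D (\<lambda>z. h (time_left z, push z))"
    proof (rule continuous_on_compose2[OF h(1)])
      show "continuous_on ?D (\<lambda>z. (time_left z, push z))"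
        by (intro continuous_on_Pair continuous_on_subset[OF continuous_push]
            continuous_on_subset[OF continuous_time_left]) auto
      show "(\<lambda>z. (time_left z, push z)) ` ?D \<subseteq> {0..1} \<times> A"
        using push_mem(3) by auto
    qed
    show "\<forall>z. z \<in> ?C \<and> time_left z \<noteq> 0 \<or> z \<in> ?D \<and> time_left z = 0 \<longrightarrow> push z = h (time_left z, push z)"
      using h0 by auto
  qed
  then have "continuous_on ?S H" using CD by simp
  moreover have "H ` ?S \<subseteq> X"
  proof (rule image_subsetI)
    fix z assume z: "z \<in> ?S"
    show "H z \<in> X"
    proof (cases "time_left z = 0")
      case True
      then show ?thesis using push_mem(1)[OF z] by (simp add: H_def)
    next
      case False
      then have "push z \<in> A" "time_left z \<in> {0..1}" using push_mem[OF z] by auto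
      then have "h (time_left z, push z) \<in> A" using h(2) by blast
      then show ?thesis using False A_subset_X by (auto simp: H_def)
    qed
  qed
  moreover have "H (0, x) = x" if "x \<in> X" for x
    using that
  proof (cases rule: X_cases)
    case 1
    then show ?thesis by (simp add: H_def push_A)
  next
    case (2 i)
    have "0 \<le> (real m + 1) * \<mu> i x" using 2 by simp
    then have "dilation 0 i x = 1" "time_left (0, x) = 0"
      using push_simplex(2)[OF 2(1,4), of 0] by (simp_all add: dilation_def max_def)
    then show ?thesis using push_simplex(1)[OF 2(1,4), of 0] by (simp add: H_def)
  qed
  moreover have H_A: "H (t, x) = h (t, x)" if "t \<in> {0..1}" "x \<in> A" for t x
    using that h0 by (auto simp: H_def push_A)
  have "H (t, x) \<in> A" if "t \<in> {0..1}" "x \<in> A" for t x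
    using that h(2) H_A by (metis SigmaI image_subset_iff)
  moreover have "H (1, x) = a" if "x \<in> A" for x
    using that h1 H_A by auto
  ultimately show ?thesis using that by blast
qed

section \<open>The map collapsing the contractible subcomplex\<close>

definition "collapse x = (if \<exists>i<c. 0 < \<mu> i x
   then let i = (THE i. i < c \<and> 0 < \<mu> i x) in wedge_point c m i (simplex_to_sphere m (e i) x)
   else wedge_point c m 0 nsphere_base)"

lemma collapse_A: "x \<in> A \<Longrightarrow> collapse x = wedge_point c m 0 nsphere_base"
  using \<mu>_A by (auto simp: collapse_def)

lemma wedge_point_base: "i < c \<Longrightarrow> wedge_point c m i nsphere_base = wedge_point c m 0 nsphere_base"
  using c_pos by (simp add: wedge_point_eq_iff nsphere_base_in_nsphere)

lemma simplex_subset_X: "i < c \<Longrightarrow> geom_simplex (F i) \<subseteq> X"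
  by (auto simp: X_def underlying_space_def)

lemma collapse_simplex:
  assumes i: "i < c" and x: "x \<in> geom_simplex (F i)"
  shows "collapse x = wedge_point c m i (simplex_to_sphere m (e i) x)"
proof (cases "\<mu> i x = 0")
  case True
  then have "simplex_to_sphere m (e i) x = nsphere_base"
    using simplex_to_sphere_eq_base_iff[OF bij[OF i] x] by (simp add: \<mu>_def)
  then show ?thesis using collapse_A simplex_boundary_A[OF i x True] wedge_point_base[OF i] by simp
next
  case False
  have xX: "x \<in> X" using simplex_subset_X i x by blast
  then have pos: "0 < \<mu> i x" using False \<mu>_nonneg[OF i] by fastforce
  \<comment> \<open>The description has a referent because no point of X is interior to two
    facets.\<close>
  then have "(THE i. i < c \<and> 0 < \<mu> i x) = i"
    using i \<mu>_pos_unique[OF _ i xX _ pos] by blast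
  then show ?thesis using pos i by (auto simp: collapse_def Let_def)
qed

lemma collapse_eq_base_iff:
  assumes "x \<in> X"
  shows "collapse x = wedge_point c m 0 nsphere_base \<longleftrightarrow> x \<in> A"
proof
  assume eq: "collapse x = wedge_point c m 0 nsphere_base"
  show "x \<in> A" using assms
  proof (cases rule: X_cases)
    case (2 i)
    then have "simplex_to_sphere m (e i) x = nsphere_base"
      using eq collapse_simplex[OF 2(1,3)] c_pos simplex_to_sphere_in_nsphere[OF bij[OF 2(1)] 2(3)]
      by (auto simp: wedge_point_eq_iff nsphere_base_in_nsphere)
    then show ?thesis using 2(2) simplex_to_sphere_eq_base_iff[OF bij[OF 2(1)] 2(3)] by (simp add: \<mu>_def)
  qed
qed (rule collapse_A)

text \<open>Interiors of the facets are mapped injectively and away from the base point, so A is the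
  only fibre that can have several points: the wedge is X with A collapsed.\<close>

lemma collapse_eq:
  assumes "x \<in> X" "y \<in> X" "collapse x = collapse y"
  shows "x = y \<or> x \<in> A \<and> y \<in> A"
proof (cases "x \<in> A \<or> y \<in> A")
  case True
  then show ?thesis using assms collapse_eq_base_iff by metis
next
  case False
  obtain i where i: "i < c" "0 < \<mu> i x" "x \<in> geom_simplex (F i)" using X_cases[OF assms(1)] False by metis
  obtain j where j: "j < c" "0 < \<mu> j y" "y \<in> geom_simplex (F j)" using X_cases[OF assms(2)] False by metis
  have nb: "simplex_to_sphere m (e i) x \<noteq> nsphere_base"
    using i(2) simplex_to_sphere_eq_base_iff[OF bij[OF i(1)] i(3)] by (simp add: \<mu>_def)
  have "wedge_point c m i (simplex_to_sphere m (e i) x) = wedge_point c m j (simplex_to_sphere m (e j) y)"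
    using assms(3) collapse_simplex[OF i(1,3)] collapse_simplex[OF j(1,3)] by simp
  then have ij: "i = j" and eq: "simplex_to_sphere m (e i) x = simplex_to_sphere m (e j) y"
    using nb wedge_point_eq_iff[OF i(1) simplex_to_sphere_in_nsphere[OF bij[OF i(1)] i(3)]
        j(1) simplex_to_sphere_in_nsphere[OF bij[OF j(1)] j(3)]] by blast+
  have "x = y"
    using simplex_to_sphere_inj_interior[OF bij[OF i(1)] i(3) i(2)[unfolded \<mu>_def]] j eq
    unfolding ij \<mu>_def by blast
  then show ?thesis ..
qed

lemma collapse_surj: "collapse ` X = topspace (wedge_of_spheres c m)"
proof (intro equalityI subsetI)
  fix p assume "p \<in> collapse ` X"
  then obtain x where x: "x \<in> X" "p = collapse x" by blast
  from x(1) show "p \<in> topspace (wedge_of_spheres c m)"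
  proof (cases rule: X_cases)
    case 1
    then show ?thesis using x c_pos nsphere_base_in_nsphere by (auto simp: collapse_A topspace_wedge_of_spheres)
  next
    case (2 i)
    then show ?thesis using x collapse_simplex[OF 2(1,3)] simplex_to_sphere_in_nsphere[OF bij[OF 2(1)] 2(3)]
      by (auto simp: topspace_wedge_of_spheres)
  qed
next
  fix p assume "p \<in> topspace (wedge_of_spheres c m)"
  then obtain i z where iz: "i < c" "z \<in> topspace (nsphere m)" "p = wedge_point c m i z"
    by (auto simp: topspace_wedge_of_spheres)
  show "p \<in> collapse ` X"
  proof (cases "z = nsphere_base")
    case True
    obtain x where "x \<in> A" using L_nonempty by (auto simp: A_def)
    then show ?thesis using iz True wedge_point_base collapse_A A_subset_X by (metis image_eqI subsetD)
  next
    case False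
    obtain x where "x \<in> geom_simplex (F i)" "simplex_to_sphere m (e i) x = z"
      using simplex_to_sphere_surj[OF bij[OF iz(1)] iz(2) False] by blast
    then show ?thesis using iz collapse_simplex simplex_subset_X by (metis image_eqI subsetD)
  qed
qed

lemma continuous_collapse: "continuous_map (top_of_set X) (wedge_of_spheres c m) collapse"
\<comment> \<open>X is a finite union of closed pieces; the extra index \<open>c\<close> stands for
  A.\<close>
proof (rule pasting_lemma_closed[where I = "{..c}" and T = "\<lambda>i. if i < c then geom_simplex (F i) else A" and f = "\<lambda>_. collapse"])
  fix i
  assume "i \<in> {..c}"
  show "closedin (top_of_set X) (if i < c then geom_simplex (F i) else A)"
    using closed_geom_simplex closed_A simplex_subset_X A_subset_X by (auto intro: closed_subset)
  show "continuous_map (subtopology (top_of_set X) (if i < c then geom_simplex (F i) else A)) (wedge_of_spheres c m) collapse"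
  proof (cases "i < c")
    case True
    have "continuous_map (top_of_set (geom_simplex (F i))) (nsphere m) (simplex_to_sphere m (e i))"
      unfolding nsphere euclidean_product_topology
      using continuous_on_simplex_to_sphere[OF bij[OF True]] simplex_to_sphere_in_nsphere[OF bij[OF True]]
      by (auto simp: continuous_map_in_subtopology nsphere)
    from continuous_map_compose[OF this continuous_map_wedge_point[OF True]]
    have "continuous_map (top_of_set (geom_simplex (F i))) (wedge_of_spheres c m) collapse"
      by (rule continuous_map_eq) (use collapse_simplex[OF True] in auto)
    then show ?thesis using True simplex_subset_X[OF True]
      by (simp add: subtopology_subtopology Int_absorb1)
  next
    case False
    have "wedge_point c m 0 nsphere_base \<in> topspace (wedge_of_spheres c m)"
      using c_pos nsphere_base_in_nsphere by (auto simp: topspace_wedge_of_spheres)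
    then have "continuous_map (top_of_set A) (wedge_of_spheres c m) (\<lambda>_. wedge_point c m 0 nsphere_base)"
      by simp
    then have "continuous_map (top_of_set A) (wedge_of_spheres c m) collapse"
      by (rule continuous_map_eq) (auto simp: collapse_A)
    then show ?thesis using False A_subset_X by (simp add: subtopology_subtopology Int_absorb1)
  qed
next
  fix x assume "x \<in> topspace (top_of_set X)"
  then have "x \<in> X" by simp
  then show "\<exists>j. j \<in> {..c} \<and> x \<in> (if j < c then geom_simplex (F j) else A) \<and> collapse x = collapse x"
    by (cases rule: X_cases) (auto intro: exI[of _ c] less_imp_le)
qed auto

text \<open>The homotopy keeps A inside A and takes it to one point at time 1. As all other fibres
  of \<open>collapse\<close> are single points, these are the two fibre conditions of the quotient
  criterion.\<close>

lemma homotopy_equivalent_wedge_of_spheres: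
  "geom_realization (L \<union> F ` {..<c}) homotopy_equivalent_space wedge_of_spheres c m"
proof -
  obtain H a where H: "continuous_on ({0..1::real} \<times> X) H" "H ` ({0..1} \<times> X) \<subseteq> X"
    "\<And>x. x \<in> X \<Longrightarrow> H (0, x) = x"
    "\<And>t x. t \<in> {0..1} \<Longrightarrow> x \<in> A \<Longrightarrow> H (t, x) \<in> A"
    "\<And>x. x \<in> A \<Longrightarrow> H (1, x) = a"
    using contraction_extension by blast
  have "top_of_set X homotopy_equivalent_space wedge_of_spheres c m"
  proof (rule homotopy_equivalent_space_quotient[where q = collapse and H = H])
    show "compact_space (top_of_set X)" using compact_X by (simp add: compact_space_subtopology)
    show "continuous_map (prod_topology (top_of_set {0..1}) (top_of_set X)) (top_of_set X) H"
      using H(1,2) by (auto simp flip: subtopology_Times simp: continuous_map_in_subtopology)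
    show "collapse (H (t, x)) = collapse (H (t, y))"
      if "t \<in> {0..1}" "x \<in> topspace (top_of_set X)" "y \<in> topspace (top_of_set X)" "collapse x = collapse y" for t x y
      using collapse_eq[of x y] that H(4)[of t x] H(4)[of t y] by (auto simp: collapse_A)
    show "H (1, x) = H (1, y)"
      if "x \<in> topspace (top_of_set X)" "y \<in> topspace (top_of_set X)" "collapse x = collapse y" for x y
      using collapse_eq[of x y] that H(5)[of x] H(5)[of y] by auto
  qed (use Hausdorff_wedge_of_spheres continuous_collapse collapse_surj H(3) in auto)
  then show ?thesis
    using finite_L by (simp add: X_def geom_realization_eq_underlying_space)
qed

end

section \<open>The combinatorics of singletons, pairs and triples\<close>

definition vertices :: "nat \<Rightarrow> nat set set" where
  "vertices n = layer n 1 \<union> layer n 2 \<union> layer n 3"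

definition VR :: "nat \<Rightarrow> nat set set set" where
  "VR n = Vietoris_Rips (vertices n) symdiff_dist 3"

lemma vertices_iff: "A \<in> vertices n \<longleftrightarrow> A \<subseteq> {1..n} \<and> card A \<in> {1, 2, 3}"
  by (auto simp: vertices_def layer_def)

lemma vertex_subset: "A \<in> vertices n \<Longrightarrow> A \<subseteq> {1..n}"
  by (simp add: vertices_iff)

lemma vertex_card: "A \<in> vertices n \<Longrightarrow> card A = 1 \<or> card A = 2 \<or> card A = 3"
  by (simp add: vertices_iff)

lemma VR_vertex: "\<rho> \<in> VR n \<Longrightarrow> A \<in> \<rho> \<Longrightarrow> A \<in> vertices n"
  by (auto simp: VR_def Vietoris_Rips_def)

lemma finite_vertices: "finite (vertices n)"
  by (rule finite_subset[of _ "Pow {1..n}"]) (use vertices_iff in blast, simp)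

lemma vertex_finite: "A \<in> vertices n \<Longrightarrow> finite A"
  by (auto simp: vertices_iff intro: finite_subset)

lemma symdiff_dist_le_3_iff:
  assumes "finite A" "finite B"
  shows "symdiff_dist A B \<le> 3 \<longleftrightarrow> card A + card B \<le> 3 + 2 * card (A \<inter> B)"
proof -
  have "card (sym_diff A B) = card (A - B) + card (B - A)"
    using assms by (intro card_Un_disjoint) auto
  moreover have "card A = card (A - B) + card (A \<inter> B)"
    using assms by (metis card_Diff_subset_Int card_mono finite_Int inf_le1 le_add_diff_inverse2)
  moreover have "card B = card (B - A) + card (A \<inter> B)"
    using assms by (metis card_Diff_subset_Int card_mono finite_Int inf_le2 le_add_diff_inverse2 inf_commute)
  ultimately have "card (sym_diff A B) \<le> 3 \<longleftrightarrow> card A + card B \<le> 3 + 2 * card (A \<inter> B)" by linarith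
  then show ?thesis unfolding symdiff_dist_def by linarith
qed

text \<open>Distance at most 3, using |A| + |B| - 2 |A \<inter> B| for the size of the symmetric
  difference; the negative term is moved across to avoid subtraction of natural numbers.\<close>

definition adj :: "nat set \<Rightarrow> nat set \<Rightarrow> bool" where
  "adj A B \<longleftrightarrow> card A + card B \<le> 3 + 2 * card (A \<inter> B)"

lemma adj_commute: "adj A B \<longleftrightarrow> adj B A"
  by (simp add: adj_def Int_commute add.commute)

lemma VR_iff:
  "\<rho> \<in> VR n \<longleftrightarrow> \<rho> \<subseteq> vertices n \<and> \<rho> \<noteq> {} \<and> (\<forall>A\<in>\<rho>. \<forall>B\<in>\<rho>. adj A B)"
proof (cases "\<rho> \<subseteq> vertices n \<and> \<rho> \<noteq> {}")
  case True
  then have "finite \<rho>" using finite_vertices finite_subset by blast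
  then have "\<rho> \<in> VR n \<longleftrightarrow> (\<forall>A\<in>\<rho>. \<forall>B\<in>\<rho>. symdiff_dist A B \<le> 3)"
    using True by (simp add: VR_def Vietoris_Rips_def diam_le_iff)
  also have "\<dots> \<longleftrightarrow> (\<forall>A\<in>\<rho>. \<forall>B\<in>\<rho>. adj A B)"
  proof (intro ball_cong refl)
    fix A B assume "A \<in> \<rho>" "B \<in> \<rho>"
    then have "finite A" "finite B" using True vertex_finite by blast+
    then show "symdiff_dist A B \<le> 3 \<longleftrightarrow> adj A B" by (simp add: symdiff_dist_le_3_iff adj_def)
  qed
  finally show ?thesis using True by simp
qed (auto simp: VR_def Vietoris_Rips_def)

lemma finite_VR: "finite (VR n)"
  by (rule finite_subset[of _ "Pow (vertices n)"]) (auto simp: VR_def Vietoris_Rips_def finite_vertices)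

lemma VR_simplex_finite: "\<rho> \<in> VR n \<Longrightarrow> finite \<rho>"
  using finite_vertices finite_subset by (auto simp: VR_iff)

lemma VR_down: "\<rho> \<in> VR n \<Longrightarrow> \<tau> \<subseteq> \<rho> \<Longrightarrow> \<tau> \<noteq> {} \<Longrightarrow> \<tau> \<in> VR n"
  unfolding VR_iff by blast

text \<open>Bounded diameter is a condition on pairs of vertices, so the complex is flag and
  adjacency suffices for extending a simplex.\<close>

lemma VR_insert:
  assumes "\<rho> \<in> VR n" "w \<in> vertices n" "\<And>A. A \<in> \<rho> \<Longrightarrow> adj w A"
  shows "insert w \<rho> \<in> VR n"
proof -
  have "adj w w" using assms(2) by (auto simp: vertices_iff adj_def)
  then show ?thesis using assms adj_commute unfolding VR_iff by blast
qed

section \<open>Triples and pairs inside a four-element set\<close>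

definition triples :: "'a set \<Rightarrow> 'a set set" where
  "triples S = {T. T \<subseteq> S \<and> card T = 3}"

definition pairs :: "'a set \<Rightarrow> 'a set set" where
  "pairs S = {T. T \<subseteq> S \<and> card T = 2}"

lemma triples_Diff: "card S = 4 \<Longrightarrow> v \<in> S \<Longrightarrow> S - {v} \<in> triples S"
  by (auto simp: triples_def)

lemma triple_eq_Diff:
  assumes "card S = 4" "T \<in> triples S"
  shows "\<exists>v\<in>S. T = S - {v}"
proof -
  have "finite S" using assms card.infinite by fastforce
  then have "card (S - T) = 1" using assms by (auto simp: triples_def card_Diff_subset finite_subset)
  then obtain v where "S - T = {v}" by (auto simp: card_1_singleton_iff)
  then show ?thesis using assms by (auto simp: triples_def)
qed

lemma Union_triples:
  assumes "card S = 4"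
  shows "\<Union> (triples S) = S"
proof -
  have "v \<in> \<Union> (triples S)" if "v \<in> S" for v
  proof -
    have "card (S - {v}) \<noteq> 0" using assms that by simp
    then obtain u where "u \<in> S" "u \<noteq> v" by (metis card.empty Diff_iff ex_in_conv insertI1)
    then show ?thesis using triples_Diff[OF assms, of u] that by blast
  qed
  then show ?thesis by (auto simp: triples_def)
qed

text \<open>Adjacency to a triple T means card A \<le> 2 * card (A \<inter> T), so A meets S. Taking
  for T the triple that omits a common element gives card A \<le> 2 * (card (A \<inter> S) - 1); for
  sizes 1, 2, 3 this excludes singletons and forces A into S.\<close>

lemma neighbour_of_triples:
  assumes S: "card S = 4" and A: "card A \<in> {1, 2, 3}" and adj: "\<And>T. T \<in> triples S \<Longrightarrow> adj A T"
  shows "A \<in> triples S \<union> pairs S"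
proof -
  have finS: "finite S" and finA: "finite A" using S A card.infinite by fastforce+
  have le: "card A \<le> 2 * card (A \<inter> (S - {v}))" if "v \<in> S" for v
    using adj[OF triples_Diff[OF S that]] S that by (simp add: adj_def)
  have "A \<inter> S \<noteq> {}"
  proof
    assume e: "A \<inter> S = {}"
    obtain v where "v \<in> S" using S by (metis card.empty ex_in_conv zero_neq_numeral)
    moreover have "A \<inter> (S - {v}) = {}" using e by blast
    ultimately show False using le[of v] A by auto
  qed
  then obtain v where v: "v \<in> A" "v \<in> S" by blast
  have "A \<inter> (S - {v}) = A \<inter> S - {v}" by blast
  then have "card (A \<inter> (S - {v})) = card (A \<inter> S) - 1" using v finA by simp
  then have c: "card A \<le> 2 * (card (A \<inter> S) - 1)" using le[OF v(2)] by simp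
  have "card (A \<inter> S) \<le> card A" using finA by (simp add: card_mono)
  then have "card (A \<inter> S) = card A" "card A \<noteq> 1" using c A by auto
  then have "A \<subseteq> S" using finA by (metis card_subset_eq inf.absorb_iff1 inf_le1)
  then show ?thesis using A \<open>card A \<noteq> 1\<close> by (auto simp: triples_def pairs_def)
qed

lemma triples_subset_simplex:
  assumes "\<rho> \<in> VR n" "card S = 4" "triples S \<subseteq> \<rho>"
  shows "\<rho> \<subseteq> triples S \<union> pairs S"
proof
  fix A assume A: "A \<in> \<rho>"
  then have "card A \<in> {1, 2, 3}" using assms(1) vertices_iff[of A n] unfolding VR_iff by blast
  moreover have "adj A T" if "T \<in> triples S" for T
    using that assms(1,3) A unfolding VR_iff by blast
  ultimately show "A \<in> triples S \<union> pairs S" by (rule neighbour_of_triples[OF assms(2)])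
qed

text \<open>Pairs have the wrong size to serve as triples, and the union of the triples recovers the
  four-element set. This keeps different S apart in the deletions.\<close>

lemma triples_determine:
  assumes "card S = 4" "card S' = 4" "triples S' \<subseteq> triples S \<union> pairs R"
  shows "S' = S"
proof -
  have "triples S' \<subseteq> triples S" 
  proof
    fix T assume T: "T \<in> triples S'"
    then have "card T = 3" by (simp add: triples_def)
    then have "T \<notin> pairs R" by (simp add: pairs_def)
    then show "T \<in> triples S" using T assms(3) by blast
  qed
  then have "S' \<subseteq> S" using Union_triples[OF assms(1)] Union_triples[OF assms(2)] by blast
  then show ?thesis using assms by (metis card.infinite card_subset_eq zero_neq_numeral)
qed

lemma adj_triples_triples:
  assumes "card S = 4" "T \<in> triples S" "T' \<in> triples S"
  shows "adj T T'"
proof -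
  have fin: "finite S" using assms(1) card.infinite by fastforce
  obtain v u where uv: "v \<in> S" "T = S - {v}" "u \<in> S" "T' = S - {u}" using triple_eq_Diff assms by metis
  have "card (S - {v, u}) \<ge> 2"
    using diff_card_le_card_Diff[of "{v, u}" S] assms(1) card_2_iff[of "{v,u}"] by (cases "v = u") auto
  moreover have "T \<inter> T' = S - {v, u}" using uv by blast
  ultimately show ?thesis using assms by (simp add: adj_def triples_def)
qed

lemma adj_pair_triple:
  assumes "card S = 4" "P \<in> pairs S" "T \<in> triples S"
  shows "adj P T"
proof -
  have fin: "finite S" using assms(1) card.infinite by fastforce
  have "P \<inter> T \<noteq> {}"
  proof
    assume "P \<inter> T = {}"
    moreover have "finite P" "finite T" using assms fin by (auto simp: pairs_def triples_def intro: finite_subset)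
    ultimately have "card (P \<union> T) = 5" using assms by (simp add: card_Un_disjoint pairs_def triples_def)
    moreover have "card (P \<union> T) \<le> card S" using assms fin by (intro card_mono) (auto simp: pairs_def triples_def)
    ultimately show False using assms by simp
  qed
  then have "card (P \<inter> T) \<ge> 1"
    using assms card_gt_0_iff[of "P \<inter> T"] fin by (auto simp: pairs_def Suc_le_eq intro: finite_subset)
  then show ?thesis using assms by (simp add: adj_def pairs_def triples_def)
qed

text \<open>Two pairs are adjacent iff they meet, and disjoint pairs in four elements are
  complementary. These are the antipodes of the octahedron.\<close>

lemma adj_pair_pair_iff:
  assumes "card S = 4" "P \<in> pairs S" "Q \<in> pairs S"
  shows "adj P Q \<longleftrightarrow> Q \<noteq> S - P"
proof -
  have fin: "finite S" using assms(1) card.infinite by fastforce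
  have finP: "finite P" "finite Q" using fin assms by (auto simp: pairs_def intro: finite_subset)
  have "adj P Q \<longleftrightarrow> P \<inter> Q \<noteq> {}"
    using assms finP card_gt_0_iff[of "P \<inter> Q"] by (auto simp: adj_def pairs_def)
  moreover have "P \<inter> Q = {} \<longleftrightarrow> Q = S - P"
  proof
    assume "P \<inter> Q = {}"
    then have "Q \<subseteq> S - P" using assms by (auto simp: pairs_def)
    moreover have "card (S - P) = 2" using assms finP by (simp add: card_Diff_subset pairs_def)
    ultimately show "Q = S - P" using assms fin by (intro card_subset_eq) (auto simp: pairs_def)
  qed auto
  ultimately show ?thesis by simp
qed

lemma compl_pair: "card S = 4 \<Longrightarrow> P \<in> pairs S \<Longrightarrow> S - P \<in> pairs S"
  by (auto simp: pairs_def card_Diff_subset card_ge_0_finite)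

lemma pairs_not_triples: "P \<in> pairs S \<Longrightarrow> P \<notin> triples R"
  by (auto simp: pairs_def triples_def)

section \<open>Simultaneous deletions over all four-element subsets\<close>

definition quads :: "nat \<Rightarrow> nat set set" where
  "quads n = {S. S \<subseteq> {1..n} \<and> card S = 4}"

lemma finite_quads: "finite (quads n)"
  by (rule finite_subset[of _ "Pow {1..n}"]) (unfold quads_def, blast, simp)

lemma card_quads: "card (quads n) = n choose 4"
  using n_subsets[of "{1..n}" 4] by (simp add: quads_def)

lemma pair_vertex: "S \<in> quads n \<Longrightarrow> P \<in> pairs S \<Longrightarrow> P \<in> vertices n"
  by (auto simp: quads_def pairs_def vertices_iff)

lemma triple_vertex: "S \<in> quads n \<Longrightarrow> P \<in> triples S \<Longrightarrow> P \<in> vertices n"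
  by (auto simp: quads_def triples_def vertices_iff)

text \<open>In the cross-polytope link of \<open>triples S\<close>, once \<open>p\<close> is excluded, \<open>S - p\<close> becomes a cone point.\<close>

lemma contractible_remove_vertex_of_link:
  assumes \<beta>: "\<And>S. S \<in> quads n \<Longrightarrow> triples S \<subseteq> \<beta> S \<and> \<beta> S \<subseteq> triples S \<union> pairs S"
    and p: "\<And>S. S \<in> quads n \<Longrightarrow> p S \<in> pairs S \<and> S - p S \<notin> \<beta> S"
    and con: "contractible (underlying_space {\<rho> \<in> VR n. \<forall>S\<in>quads n. \<not> \<beta> S \<subseteq> \<rho>})"
  shows "contractible (underlying_space {\<rho> \<in> VR n. \<forall>S\<in>quads n. \<not> insert (p S) (\<beta> S) \<subseteq> \<rho>})"
    (is "contractible (underlying_space ?M)")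
proof (rule contractible_delete_family[where I = "quads n" and \<sigma> = \<beta> and w = "\<lambda>S. S - p S"])
  have 4: "card S = 4" if "S \<in> quads n" for S using that by (simp add: quads_def)
  \<comment> \<open>A simplex containing \<open>triples S\<close> consists of triples and pairs of
    S, even after the cone point is added, so it has no room for the triples of another S'.\<close>
  have unique: "S' = S"
    if "S \<in> quads n" "S' \<in> quads n" "\<rho> \<in> VR n" "\<beta> S \<subseteq> \<rho>" "triples S' \<subseteq> insert (S - p S) \<rho>" for S S' \<rho>
  proof (rule triples_determine[OF 4 4])
    have "\<rho> \<subseteq> triples S \<union> pairs S"
      using triples_subset_simplex[OF that(3) 4[OF that(1)]] \<beta> that by blast
    moreover have "S - p S \<in> pairs S" using compl_pair[OF 4] p that(1) by blast
    ultimately show "triples S' \<subseteq> triples S \<union> pairs S" using that(5) by blast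
  qed (use that in auto)
  show "finite (\<beta> S) \<and> \<beta> S \<noteq> {} \<and> S - p S \<notin> \<beta> S" if "S \<in> quads n" for S
  proof -
    have "finite S" using that by (auto simp: quads_def intro: finite_subset)
    then have "finite (triples S \<union> pairs S)" by (auto simp: triples_def pairs_def)
    moreover have "triples S \<noteq> {}"
      using Union_triples[OF 4[OF that]] 4[OF that] by (metis Union_empty card.empty zero_neq_numeral)
    ultimately show ?thesis using \<beta>[OF that] p[OF that] finite_subset by blast
  qed
  show "insert (S - p S) \<rho> \<in> ?M" if "S \<in> quads n" "\<rho> \<in> ?M" "\<beta> S \<subseteq> \<rho>" for S \<rho>
  proof -
    \<comment> \<open>Since \<rho> contains \<beta> S but not
      \<open>insert (p S) (\<beta> S)\<close>, it omits \<open>p S\<close>, the only pair of S not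
      adjacent to \<open>S - p S\<close>.\<close>
    have \<rho>: "\<rho> \<in> VR n" and pn: "p S \<notin> \<rho>" using that by auto
    have w: "S - p S \<in> pairs S" using compl_pair[OF 4] p that(1) by blast
    have sub: "\<rho> \<subseteq> triples S \<union> pairs S"
      using triples_subset_simplex[OF \<rho> 4[OF that(1)]] \<beta> that by blast
    have "adj (S - p S) A" if "A \<in> \<rho>" for A
    proof (cases "A \<in> triples S")
      case True
      then show ?thesis using adj_pair_triple[OF 4 w] \<open>S \<in> quads n\<close> by blast
    next
      case False
      then have A: "A \<in> pairs S" using that sub by blast
      have "S - (S - p S) = p S" using p[OF \<open>S \<in> quads n\<close>] by (auto simp: pairs_def)
      then show ?thesis using adj_pair_pair_iff[OF 4 w A] \<open>S \<in> quads n\<close> that pn by metis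
    qed
    then have "insert (S - p S) \<rho> \<in> VR n"
      using VR_insert[OF \<rho>] pair_vertex[OF that(1) w] by blast
    \<comment> \<open>The extension must remain in the complex. A violation forces S' = S, and then
      \<open>p S\<close>, absent from \<rho>, would have to be its own complement.\<close>
    moreover have "\<not> insert (p S') (\<beta> S') \<subseteq> insert (S - p S) \<rho>" if "S' \<in> quads n" for S'
    proof
      assume *: "insert (p S') (\<beta> S') \<subseteq> insert (S - p S) \<rho>"
      then have "S' = S" using unique[OF \<open>S \<in> quads n\<close> that \<rho> \<open>\<beta> S \<subseteq> \<rho>\<close>] \<beta>[OF that] by blast
      then have "p S = S - p S" using * pn by blast
      moreover have "p S \<noteq> {}" using p[OF \<open>S \<in> quads n\<close>] by (auto simp: pairs_def)
      ultimately show False by blast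
    qed
    ultimately show ?thesis by blast
  qed
  show "\<beta> S' \<subseteq> \<rho>" if "S \<in> quads n" "S' \<in> quads n" "\<rho> \<in> ?M" "\<beta> S \<subseteq> \<rho>" "S \<noteq> S'" "\<beta> S' \<subseteq> insert (S - p S) \<rho>" for S S' \<rho>
    using unique[of S S' \<rho>] \<beta>[of S'] that by blast
  have "{\<rho> \<in> ?M. \<forall>S\<in>quads n. \<not> \<beta> S \<subseteq> \<rho>} = {\<rho> \<in> VR n. \<forall>S\<in>quads n. \<not> \<beta> S \<subseteq> \<rho>}" by blast
  then show "contractible (underlying_space {\<rho> \<in> ?M. \<forall>S\<in>quads n. \<not> \<beta> S \<subseteq> \<rho>})" using con by simp
  show "\<tau> \<in> ?M" if "\<rho> \<in> ?M" "\<tau> \<subseteq> \<rho>" "\<tau> \<noteq> {}" for \<rho> \<tau>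
    using that VR_down[of \<rho> n \<tau>] by blast
qed (use finite_quads VR_simplex_finite in auto)

text \<open>Adjacent triples share two elements. Take {p, q, r} and {p, q, s} in the family: a
  member missing p must be {q, r, s}, a member missing q must be {p, r, s}, and so without a common
  element all four triples of {p, q, r, s} occur.\<close>

lemma common_element:
  assumes \<sigma>: "\<sigma> \<noteq> {}" "\<And>T. T \<in> \<sigma> \<Longrightarrow> T \<subseteq> {1..n} \<and> card T = 3"
    and adj: "\<And>T T'. T \<in> \<sigma> \<Longrightarrow> T' \<in> \<sigma> \<Longrightarrow> adj T T'"
    and quad: "\<And>S. S \<in> quads n \<Longrightarrow> \<not> triples S \<subseteq> \<sigma>"
  shows "\<Inter>\<sigma> \<noteq> {}"
proof (rule ccontr)
  assume "\<not> \<Inter>\<sigma> \<noteq> {}"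
  then have no: "\<exists>U\<in>\<sigma>. v \<notin> U" for v by blast
  have two: "card (T \<inter> T') \<ge> 2" if "T \<in> \<sigma>" "T' \<in> \<sigma>" for T T'
    using adj[OF that] \<sigma>(2)[OF that(1)] \<sigma>(2)[OF that(2)] by (simp add: adj_def)
  have fin: "finite T" if "T \<in> \<sigma>" for T using \<sigma>(2)[OF that] finite_subset by blast
  obtain T where T: "T \<in> \<sigma>" using \<sigma>(1) by blast
  then obtain v where "v \<in> T" using \<sigma>(2)[OF T] by (metis card.empty ex_in_conv zero_neq_numeral)
  then obtain T' where T': "T' \<in> \<sigma>" "T' \<noteq> T" using no by blast
  have "\<not> T \<subseteq> T'" using T' \<sigma>(2)[OF T] \<sigma>(2)[OF T'(1)] fin[OF T'(1)] by (metis card_subset_eq)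
  then have "card (T \<inter> T') < card T"
    using fin[OF T] by (intro psubset_card_mono) auto
  then have "card (T \<inter> T') = 2" using two[OF T T'(1)] \<sigma>(2)[OF T] by linarith
  then obtain p q where pq: "T \<inter> T' = {p, q}" "p \<noteq> q" by (auto simp: card_2_iff)
  have third: "\<exists>r. U = {p, q, r} \<and> r \<noteq> p \<and> r \<noteq> q" if "U \<in> \<sigma>" "p \<in> U" "q \<in> U" for U
  proof -
    have "card (U - {p, q}) = 1" using that \<sigma>(2)[OF that(1)] pq(2) by (simp add: card_Diff_subset)
    then obtain r where "U - {p, q} = {r}" by (auto simp: card_1_singleton_iff)
    then show ?thesis using that by blast
  qed
  obtain r where r: "T = {p, q, r}" "r \<noteq> p" "r \<noteq> q" using third[OF T] pq by blast
  obtain s where s: "T' = {p, q, s}" "s \<noteq> p" "s \<noteq> q" using third[OF T'(1)] pq by blast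
  have rs: "r \<noteq> s" using r s T' by blast
  \<comment> \<open>A member missing one element of a triple in the family must contain the other
    two.\<close>
  have sub2: "{x, y} \<subseteq> U" if "U \<in> \<sigma>" "V \<in> \<sigma>" "V = {z, x, y}" "z \<notin> U" for U V x y z
  proof (rule ccontr)
    assume "\<not> {x, y} \<subseteq> U"
    then have "U \<inter> V \<subseteq> {x} \<or> U \<inter> V \<subseteq> {y}" using that by blast
    then have "card (U \<inter> V) \<le> 1"
      by (metis card.empty card.insert card_mono empty_iff finite.emptyI finite.insertI One_nat_def)
    then show False using two[OF that(1,2)] by simp
  qed
  have full: "U = X" if "U \<in> \<sigma>" "X \<subseteq> U" "card X = 3" for U X
    using that \<sigma>(2)[OF that(1)] fin[OF that(1)] by (metis card_subset_eq)
  obtain U where U: "U \<in> \<sigma>" "p \<notin> U" using no by blast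
  have "{q, r} \<subseteq> U" "{q, s} \<subseteq> U" using sub2[OF U(1) T r(1) U(2)] sub2[OF U(1) T'(1) s(1) U(2)] .
  then have U': "{q, r, s} \<in> \<sigma>" using full[OF U(1), of "{q, r, s}"] U(1) r s rs by auto
  obtain W where W: "W \<in> \<sigma>" "q \<notin> W" using no by blast
  have "T = {q, p, r}" "T' = {q, p, s}" using r s by auto
  then have "{p, r} \<subseteq> W" "{p, s} \<subseteq> W" using sub2[OF W(1) T _ W(2)] sub2[OF W(1) T'(1) _ W(2)] by blast+
  then have W': "{p, r, s} \<in> \<sigma>" using full[OF W(1), of "{p, r, s}"] W(1) r s rs by auto
  let ?S = "{p, q, r, s}"
  have S4: "card ?S = 4" using pq r s rs by auto
  have "?S \<in> quads n" using S4 \<sigma>(2)[OF T] \<sigma>(2)[OF T'(1)] r s by (auto simp: quads_def)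
  moreover have "triples ?S \<subseteq> \<sigma>"
  proof
    fix V assume "V \<in> triples ?S"
    then obtain v where v: "v \<in> ?S" "V = ?S - {v}" using triple_eq_Diff[OF S4] by blast
    have D: "?S - {p} = {q, r, s}" "?S - {q} = {p, r, s}" "?S - {r} = T'" "?S - {s} = T"
      using pq r s rs by auto
    consider "v = p" | "v = q" | "v = r" | "v = s" using v(1) by blast
    then show "V \<in> \<sigma>" by cases (use v(2) D U' W' T T'(1) in metis)+
  qed
  ultimately show False using quad by blast
qed

section \<open>Filtration by the number of triples\<close>

definition triples_in :: "nat set set \<Rightarrow> nat set set" where
  "triples_in \<rho> = {T \<in> \<rho>. card T = 3}"

lemma adj_singleton: "finite A \<Longrightarrow> card A \<in> {1, 2} \<or> card A = 3 \<and> v \<in> A \<Longrightarrow> adj {v} A"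
  by (auto simp: adj_def)

text \<open>\<open>M k\<close> allows at most k triples per simplex. Passing from
  \<open>Suc k\<close> to k deletes the star of every simplex made of exactly \<open>Suc k\<close>
  triples, with apex {v} for a common element v. A singleton is adjacent to all singletons and
  pairs, and adding it changes no set of triples, so it neither leaves the filtration level nor
  completes another deleted simplex.\<close>

lemma contractible_no_full_quad:
  assumes "n \<ge> 1"
  shows "contractible (underlying_space {\<rho> \<in> VR n. \<forall>S\<in>quads n. \<not> triples S \<subseteq> \<rho>})"
    (is "contractible (underlying_space ?K)")
proof -
  define M where "M k = {\<rho> \<in> ?K. card (triples_in \<rho>) \<le> k}" for k
  have Kfin: "finite \<rho>" if "\<rho> \<in> ?K" for \<rho> using that VR_simplex_finite by blast
  have triples_insert: "triples_in (insert {v} \<rho>) = triples_in \<rho>" for v \<rho>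
    by (auto simp: triples_in_def)
  have K_insert: "insert {v} \<rho> \<in> ?K" if \<rho>: "\<rho> \<in> ?K" and v: "v \<in> {1..n}" "\<And>T. T \<in> triples_in \<rho> \<Longrightarrow> v \<in> T" for v \<rho>
  proof -
    have "adj {v} A" if "A \<in> \<rho>" for A
    proof -
      have A: "A \<in> vertices n" using \<rho> VR_vertex[OF _ that] by blast
      have "v \<in> A" if "card A = 3" using v(2)[of A] that \<open>A \<in> \<rho>\<close> by (simp add: triples_in_def)
      then show ?thesis using vertex_card[OF A] by (intro adj_singleton vertex_finite[OF A]) blast
    qed
    moreover have "{v} \<in> vertices n" using v(1) by (simp add: vertices_iff)
    ultimately have "insert {v} \<rho> \<in> VR n" using \<rho> VR_insert[of \<rho> n "{v}"] by blast
    moreover have "\<not> triples S \<subseteq> insert {v} \<rho>" if "S \<in> quads n" for S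
    proof
      assume "triples S \<subseteq> insert {v} \<rho>"
      moreover have "{v} \<notin> triples S" by (simp add: triples_def)
      ultimately show False using \<rho> that by blast
    qed
    ultimately show ?thesis by blast
  qed
  have "contractible (underlying_space (M k))" for k
  proof (induction k)
    case 0
    have "triples_in \<rho> = {}" if "\<rho> \<in> M 0" for \<rho>
      using that Kfin[of \<rho>] by (auto simp: M_def triples_in_def)
    then have "insert {1} \<rho> \<in> M 0" if "\<rho> \<in> M 0" for \<rho>
      using that K_insert[of \<rho> 1] assms triples_insert by (auto simp: M_def)
    then show ?case
      using Kfin by (intro contractible_cone) (auto simp: M_def)
  next
    case (Suc k)
    define I where "I = {\<sigma> \<in> ?K. triples_in \<sigma> = \<sigma> \<and> card \<sigma> = Suc k}"
    define w where "w \<sigma> = {SOME v. v \<in> \<Inter>\<sigma>}" for \<sigma> :: "nat set set"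
    have I_card: "card T = 3" if "\<sigma> \<in> I" "T \<in> \<sigma>" for \<sigma> T
      using that by (auto simp: I_def triples_in_def)
    have w: "\<exists>v\<in>{1..n}. w \<sigma> = {v} \<and> (\<forall>T\<in>\<sigma>. v \<in> T)" if "\<sigma> \<in> I" for \<sigma>
    proof -
      have \<sigma>: "\<sigma> \<in> VR n" "\<sigma> \<noteq> {}" using that unfolding I_def VR_iff by blast+
      have "\<Inter>\<sigma> \<noteq> {}"
      proof (rule common_element[of _ n])
        show "T \<subseteq> {1..n} \<and> card T = 3" if "T \<in> \<sigma>" for T
          using vertex_subset[OF VR_vertex[OF \<sigma>(1) that]] I_card[OF \<open>\<sigma> \<in> I\<close> that] by simp
        show "adj T T'" if "T \<in> \<sigma>" "T' \<in> \<sigma>" for T T' using \<sigma>(1) that unfolding VR_iff by blast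
        show "\<not> triples S \<subseteq> \<sigma>" if "S \<in> quads n" for S using \<open>\<sigma> \<in> I\<close> that by (simp add: I_def)
      qed (rule \<sigma>(2))
      then have v: "(SOME v. v \<in> \<Inter>\<sigma>) \<in> \<Inter>\<sigma>" by (rule some_in_eq[THEN iffD2])
      moreover obtain T where "T \<in> \<sigma>" using \<sigma>(2) by blast
      then have "\<Inter>\<sigma> \<subseteq> {1..n}" using vertex_subset[OF VR_vertex[OF \<sigma>(1)]] by blast
      ultimately show ?thesis unfolding w_def by blast
    qed
    have w_not: "w \<sigma> \<notin> \<sigma>'" if "\<sigma> \<in> I" "\<sigma>' \<in> I" for \<sigma> \<sigma>'
      using w[OF that(1)] I_card[OF that(2)] by fastforce
    \<comment> \<open>The bound \<open>Suc k\<close> is already used up by \<sigma>, so an element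
      common to \<sigma> is common to all triples of \<rho>.\<close>
    have Tr: "triples_in \<rho> = \<sigma>" if "\<sigma> \<in> I" "\<rho> \<in> M (Suc k)" "\<sigma> \<subseteq> \<rho>" for \<sigma> \<rho>
    proof -
      have "\<sigma> \<subseteq> triples_in \<rho>" using I_card[OF that(1)] that(3) by (auto simp: triples_in_def)
      moreover have "finite (triples_in \<rho>)" using Kfin[of \<rho>] that(2) by (auto simp: M_def triples_in_def)
      moreover have "card (triples_in \<rho>) \<le> card \<sigma>" using that by (simp add: M_def I_def)
      ultimately show ?thesis by (metis card_seteq)
    qed
    show ?case
    proof (rule contractible_delete_family[where I = I and \<sigma> = "\<lambda>\<sigma>. \<sigma>" and w = w])
      show "finite I" using finite_VR[of n] by (auto simp: I_def)
      show "finite \<rho>" if "\<rho> \<in> M (Suc k)" for \<rho> using that Kfin by (simp add: M_def)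
      show "\<tau> \<in> M (Suc k)" if "\<rho> \<in> M (Suc k)" "\<tau> \<subseteq> \<rho>" "\<tau> \<noteq> {}" for \<rho> \<tau>
      proof -
        have "\<tau> \<in> ?K" using that VR_down[of \<rho> n \<tau>] by (auto simp: M_def)
        moreover have "card (triples_in \<tau>) \<le> card (triples_in \<rho>)"
          using that Kfin[of \<rho>] by (intro card_mono) (auto simp: M_def triples_in_def)
        ultimately show ?thesis using that by (simp add: M_def)
      qed
      show "finite \<sigma> \<and> \<sigma> \<noteq> {} \<and> w \<sigma> \<notin> \<sigma>" if "\<sigma> \<in> I" for \<sigma>
        using that w_not[OF that that] Kfin[of \<sigma>] unfolding I_def VR_iff by blast
      show "insert (w \<sigma>) \<rho> \<in> M (Suc k)" if \<sigma>\<rho>: "\<sigma> \<in> I" "\<rho> \<in> M (Suc k)" "\<sigma> \<subseteq> \<rho>" for \<sigma> \<rho>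
      proof -
        obtain v where v: "v \<in> {1..n}" "w \<sigma> = {v}" "\<forall>T\<in>\<sigma>. v \<in> T" using w[OF \<sigma>\<rho>(1)] by blast
        have "insert {v} \<rho> \<in> ?K"
          using K_insert[of \<rho> v] v Tr[OF \<sigma>\<rho>] \<sigma>\<rho>(2) by (simp add: M_def)
        then show ?thesis using v \<sigma>\<rho> triples_insert by (simp add: M_def)
      qed
      show "\<sigma>' \<subseteq> \<rho>" if "\<sigma> \<in> I" "\<sigma>' \<in> I" "\<sigma>' \<subseteq> insert (w \<sigma>) \<rho>" for \<sigma> \<sigma>' \<rho>
        using that w_not[OF that(1,2)] by blast
      have "{\<rho> \<in> M (Suc k). \<forall>\<sigma>\<in>I. \<not> \<sigma> \<subseteq> \<rho>} = M k"
      proof (intro equalityI subsetI)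
        fix \<rho> assume \<rho>: "\<rho> \<in> {\<rho> \<in> M (Suc k). \<forall>\<sigma>\<in>I. \<not> \<sigma> \<subseteq> \<rho>}"
        have "card (triples_in \<rho>) \<noteq> Suc k"
        proof
          assume c: "card (triples_in \<rho>) = Suc k"
          have sub: "triples_in \<rho> \<subseteq> \<rho>" by (auto simp: triples_in_def)
          moreover have "triples_in \<rho> \<noteq> {}" using c by auto
          ultimately have "triples_in \<rho> \<in> ?K" using \<rho> VR_down[of \<rho> n "triples_in \<rho>"] unfolding M_def by blast
          then have "triples_in \<rho> \<in> I" using c by (auto simp: I_def triples_in_def)
          then show False using \<rho> sub by blast
        qed
        then show "\<rho> \<in> M k" using \<rho> by (auto simp: M_def)
      next
        fix \<rho> assume \<rho>: "\<rho> \<in> M k"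
        then have "\<rho> \<in> M (Suc k)" by (auto simp: M_def)
        moreover have "\<not> \<sigma> \<subseteq> \<rho>" if "\<sigma> \<in> I" for \<sigma>
        proof
          assume "\<sigma> \<subseteq> \<rho>"
          then have "triples_in \<rho> = \<sigma>" using Tr[OF that \<open>\<rho> \<in> M (Suc k)\<close>] by simp
          then show False using that \<rho> by (simp add: I_def M_def)
        qed
        ultimately show "\<rho> \<in> {\<rho> \<in> M (Suc k). \<forall>\<sigma>\<in>I. \<not> \<sigma> \<subseteq> \<rho>}" by blast
      qed
      then show "contractible (underlying_space {\<rho> \<in> M (Suc k). \<forall>\<sigma>\<in>I. \<not> \<sigma> \<subseteq> \<rho>})" using Suc by simp
    qed
  qed
  moreover have "card (triples_in \<rho>) \<le> card (vertices n)" if "\<rho> \<in> ?K" for \<rho>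
    using that VR_vertex[of \<rho> n] by (intro card_mono finite_vertices) (auto simp: triples_in_def)
  then have "M (card (vertices n)) = ?K" unfolding M_def by blast
  ultimately show ?thesis by metis
qed

theorem theorem3p5:
  fixes n :: nat
  assumes "n \<ge> 4"
  shows "geom_realization (Vietoris_Rips (layer n 1 \<union> layer n 2 \<union> layer n 3) symdiff_dist 3)
           homotopy_equivalent_space wedge_of_spheres (n choose 4) 6"
proof -
  have 4: "card S = 4" if "S \<in> quads n" for S using that by (simp add: quads_def)
  \<comment> \<open>The pairs avoiding one fixed element contain exactly one of each two
    complementary pairs, hence form a facet of the octahedron; the minimum is merely a convenient
    choice of that element.\<close>
  define H where "H S = pairs (S - {Min S})" for S :: "nat set"
  define F where "F S = triples S \<union> H S" for S
  have fin: "finite S" and Min: "Min S \<in> S" if "S \<in> quads n" for S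
  proof -
    show "finite S" using 4[OF that] card.infinite by fastforce
    then show "Min S \<in> S" using 4[OF that] by (intro Min_in) auto
  qed
  have H: "H S \<subseteq> pairs S" "card (H S) = 3" "\<forall>P\<in>pairs S. (P \<in> H S) \<noteq> (S - P \<in> H S)" if "S \<in> quads n" for S
  proof -
    show "H S \<subseteq> pairs S" by (auto simp: H_def pairs_def)
    have "card (S - {Min S}) = 3" using 4[OF that] Min[OF that] by simp
    then show "card (H S) = 3"
      using n_subsets[of "S - {Min S}" 2] fin[OF that] by (simp add: H_def pairs_def eval_nat_numeral)
    show "\<forall>P\<in>pairs S. (P \<in> H S) \<noteq> (S - P \<in> H S)"
    proof
      fix P assume P: "P \<in> pairs S"
      then have "P \<in> H S \<longleftrightarrow> Min S \<notin> P" by (auto simp: H_def pairs_def)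
      moreover have "S - P \<in> H S \<longleftrightarrow> Min S \<in> P"
        using compl_pair[OF 4[OF that] P] Min[OF that] by (auto simp: H_def pairs_def)
      ultimately show "(P \<in> H S) \<noteq> (S - P \<in> H S)" by blast
    qed
  qed
  have "\<forall>S\<in>quads n. \<exists>p1 p2 p3. H S = {p1, p2, p3}"
    using H(2) by (meson card_3_iff)
  then obtain p1 p2 p3 where p: "\<And>S. S \<in> quads n \<Longrightarrow> H S = {p1 S, p2 S, p3 S}"
    by metis
  \<comment> \<open>No two members of \<open>H S\<close> are antipodal. This makes
    \<open>F S\<close> a simplex and provides the absent cone points for the deletions.\<close>
  have compl: "S - P \<notin> triples S \<union> H S" if "S \<in> quads n" "P \<in> H S" for S P
    using H[OF that(1)] that(2) compl_pair[OF 4[OF that(1)], of P] pairs_not_triples by blast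
  let ?L = "{\<rho> \<in> VR n. \<forall>S\<in>quads n. \<not> F S \<subseteq> \<rho>}"
  have con: "contractible (underlying_space ?L)"
  proof -
    have step: "contractible (underlying_space {\<rho> \<in> VR n. \<forall>S\<in>quads n. \<not> insert (q S) (\<beta> S) \<subseteq> \<rho>})"
      if \<beta>: "\<And>S. S \<in> quads n \<Longrightarrow> triples S \<subseteq> \<beta> S \<and> \<beta> S \<subseteq> triples S \<union> H S \<and> q S \<in> H S"
        and "contractible (underlying_space {\<rho> \<in> VR n. \<forall>S\<in>quads n. \<not> \<beta> S \<subseteq> \<rho>})" for q \<beta>
    proof (rule contractible_remove_vertex_of_link[OF _ _ that(2)])
      fix S assume S: "S \<in> quads n"
      show "triples S \<subseteq> \<beta> S \<and> \<beta> S \<subseteq> triples S \<union> pairs S" using \<beta>[OF S] H(1)[OF S] by blast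
      show "q S \<in> pairs S \<and> S - q S \<notin> \<beta> S" using \<beta>[OF S] H(1)[OF S] compl[OF S, of "q S"] by blast
    qed
    have "contractible (underlying_space {\<rho> \<in> VR n. \<forall>S\<in>quads n.
        \<not> insert (p3 S) (insert (p2 S) (insert (p1 S) (triples S))) \<subseteq> \<rho>})"
      \<comment> \<open>Three uses of \<open>step\<close> peel off \<open>p3\<close>,
        \<open>p2\<close> and \<open>p1\<close>, ending at the complex without any full
        \<open>triples S\<close>.\<close>
      by (intro step contractible_no_full_quad) (use p assms in auto)
    moreover have "insert (p3 S) (insert (p2 S) (insert (p1 S) (triples S))) = F S" if "S \<in> quads n" for S
      using p[OF that] by (auto simp: F_def)
    ultimately show ?thesis by simp
  qed
  have F_sub: "F S \<subseteq> triples S \<union> pairs S" if "S \<in> quads n" for S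
    using H(1)[OF that] by (auto simp: F_def)
  have F_VR: "F S \<in> VR n" if S: "S \<in> quads n" for S
    unfolding VR_iff
  proof (intro conjI ballI)
    show "F S \<subseteq> vertices n"
      using F_sub[OF S] pair_vertex[OF S] triple_vertex[OF S] by blast
    show "F S \<noteq> {}" using p[OF S] by (simp add: F_def)
    fix A B assume A: "A \<in> F S" and B: "B \<in> F S"
    show "adj A B"
    proof (cases "A \<in> triples S"; cases "B \<in> triples S")
      assume "A \<in> triples S" "B \<in> triples S"
      then show ?thesis by (rule adj_triples_triples[OF 4[OF S]])
    next
      assume "A \<in> triples S" "B \<notin> triples S"
      then have "B \<in> pairs S" using F_sub[OF S] B by blast
      then have "adj B A" using \<open>A \<in> triples S\<close> by (rule adj_pair_triple[OF 4[OF S]])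
      then show ?thesis by (simp add: adj_commute)
    next
      assume "A \<notin> triples S" "B \<in> triples S"
      then have "A \<in> pairs S" using F_sub[OF S] A by blast
      then show ?thesis using \<open>B \<in> triples S\<close> by (rule adj_pair_triple[OF 4[OF S]])
    next
      assume "A \<notin> triples S" "B \<notin> triples S"
      then have AB: "A \<in> H S" "B \<in> H S" using A B by (auto simp: F_def)
      then have "B \<noteq> S - A" using compl[OF S, of A] by blast
      then show ?thesis using adj_pair_pair_iff[OF 4[OF S], of A B] AB H(1)[OF S] by blast
    qed
  qed
  have F_unique: "S' = S" if S: "S \<in> quads n" and S': "S' \<in> quads n" and sub: "triples S' \<subseteq> F S" for S S'
    using triples_determine[OF 4[OF S] 4[OF S'], of S] sub F_sub[OF S] by blast
  \<comment> \<open>A further vertex would be a pair outside \<open>H S\<close>; its complement lies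
    in \<open>H S\<close> and is not adjacent to it.\<close>
  have F_facet: "\<rho> = F S" if \<rho>: "\<rho> \<in> VR n" and S: "S \<in> quads n" and sub: "F S \<subseteq> \<rho>" for \<rho> S
  proof
    have \<rho>_sub: "\<rho> \<subseteq> triples S \<union> pairs S"
      using triples_subset_simplex[OF \<rho> 4[OF S]] sub by (auto simp: F_def)
    show "\<rho> \<subseteq> F S"
    proof
      fix A assume A: "A \<in> \<rho>"
      show "A \<in> F S"
      proof (rule ccontr)
        assume no: "A \<notin> F S"
        then have AP: "A \<in> pairs S" using \<rho>_sub A by (auto simp: F_def)
        then have c: "S - A \<in> H S" using H(3)[OF S] no by (auto simp: F_def)
        then have "S - A \<in> \<rho>" using sub by (auto simp: F_def)
        then have "adj A (S - A)" using \<rho> A unfolding VR_iff by blast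
        then show False using adj_pair_pair_iff[OF 4[OF S] AP, of "S - A"] c H(1)[OF S] by blast
      qed
    qed
  qed (rule sub)
  \<comment> \<open>Four triples and three pairs: seven vertices span a simplex of dimension 6, the
    dimension of the spheres.\<close>
  have F_card: "card (F S) = 7" if S: "S \<in> quads n" for S
  proof -
    have "card (triples S) = 4"
      using n_subsets[OF fin[OF S], of 3] 4[OF S] by (simp add: triples_def eval_nat_numeral)
    moreover have "finite (triples S)" using fin[OF S] by (simp add: triples_def)
    moreover have "triples S \<inter> H S = {}" using H(1)[OF S] pairs_not_triples by blast
    moreover have "finite (H S)" using p[OF S] by simp
    ultimately show ?thesis using H(2)[OF S] by (simp add: F_def card_Un_disjoint)
  qed
  define c where "c = n choose 4"
  have "card (quads n) = card {..<c}" by (simp add: card_quads c_def)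
  then obtain Q where Q: "bij_betw Q {..<c} (quads n)"
    using finite_quads finite_same_card_bij[of "{..<c}" "quads n"] by auto
  have Qi: "Q i \<in> quads n" if "i < c" for i using Q that by (auto simp: bij_betw_def)
  have "\<exists>e. bij_betw e {..6::nat} (F (Q i))" if "i < c" for i
    using F_card[OF Qi[OF that]] card.infinite[of "F (Q i)"] by (intro finite_same_card_bij) auto
  then obtain e where e: "\<And>i. i < c \<Longrightarrow> bij_betw (e i) {..6::nat} (F (Q i))" by metis
  have FQ: "(\<lambda>i. F (Q i)) ` {..<c} = F ` quads n" using Q by (metis bij_betw_def image_image)
  interpret facet_attachment ?L "\<lambda>i. F (Q i)" e c 6
  proof
    show "finite ?L" using finite_VR by auto
    show "finite \<rho>" if "\<rho> \<in> ?L" for \<rho> using that VR_simplex_finite by blast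
    show "\<tau> \<in> ?L" if "\<rho> \<in> ?L" "\<tau> \<subseteq> \<rho>" "\<tau> \<noteq> {}" for \<rho> \<tau>
      using that VR_down[of \<rho> n \<tau>] by blast
    show "bij_betw (e i) {..6} (F (Q i))" if "i < c" for i using e[OF that] .
    show "F (Q i) \<notin> ?L" if "i < c" for i using Qi[OF that] by blast
    show "\<rho> \<in> ?L" if i: "i < c" and sub: "\<rho> \<subset> F (Q i)" and ne: "\<rho> \<noteq> {}" for i \<rho>
    proof -
      have "\<rho> \<in> VR n" using VR_down[OF F_VR[OF Qi[OF i]], of \<rho>] sub ne by blast
      moreover have "\<not> F S \<subseteq> \<rho>" if S: "S \<in> quads n" for S
      proof
        assume "F S \<subseteq> \<rho>"
        moreover from this have "S = Q i" using F_unique[OF Qi[OF i] S] sub by (auto simp: F_def[of S])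
        ultimately show False using sub by blast
      qed
      ultimately show ?thesis by blast
    qed
    show "inj_on (\<lambda>i. F (Q i)) {..<c}"
    proof (rule inj_onI)
      fix i j assume ij: "i \<in> {..<c}" "j \<in> {..<c}" "F (Q i) = F (Q j)"
      then have "Q j = Q i" using F_unique[of "Q i" "Q j"] Qi by (auto simp: F_def[of "Q j"])
      then show "i = j" using Q ij by (auto simp: bij_betw_def inj_on_def)
    qed
    show "0 < c" using assms by (simp add: c_def)
    show "contractible (underlying_space ?L)" by (rule con)
    show "underlying_space ?L \<noteq> {}"
    proof -
      have "{1} \<in> vertices n" using assms by (simp add: vertices_iff)
      then have "{{1}} \<in> VR n" by (simp add: VR_iff adj_def)
      \<comment> \<open>Seven vertices do not fit into a single one.\<close>
      moreover have "\<not> F S \<subseteq> {{1}}" if "S \<in> quads n" for S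
        using card_mono[of "{{1}}" "F S"] F_card[OF that] by auto
      ultimately have "{{1}} \<in> ?L" by blast
      moreover have "(\<lambda>v. if v = {1} then 1 else 0) \<in> geom_simplex {{1}}" by (simp add: geom_simplex_def)
      ultimately show ?thesis unfolding underlying_space_def by blast
    qed
  qed
  \<comment> \<open>By maximality the only simplex containing \<open>F S\<close> is
    \<open>F S\<close> itself, so exactly these facets are missing from \<open>?L\<close>.\<close>
  have "VR n = ?L \<union> (\<lambda>i. F (Q i)) ` {..<c}"
    unfolding FQ using F_VR F_facet by blast
  then show ?thesis
    using homotopy_equivalent_wedge_of_spheres by (simp add: VR_def vertices_def c_def)
qed

end
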